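(* Let $H\in(0,1)$, $\lambda>0$, $x\in\mathbb{R}$ and $p\ge1$. For $\varepsilon>0$ let $(X^{\varepsilon,H}_t(x))_{t\ge0}$ be the fractional Ornstein--Uhlenbeck process solving $\mathrm{d}X^{\varepsilon,H}_t=-\lambda X^{\varepsilon,H}_t\,\mathrm{d}t+\varepsilon\,\mathrm{d}B^H_t$, $X^{\varepsilon,H}_0=x$, where $(B^H_t)_{t\ge 0}$ is a fractional Brownian motion on $\mathbb{R}$ with Hurst exponent $H$. Put $\mathcal{R}:=\frac{\lambda^{-2H}\Gamma(2H+1)}{2}$ and let $X^{\varepsilon,H}_\infty$ be a random variable with law $\mathcal{N}(0,\varepsilon^2\mathcal{R})$ (the limiting law of $X^{\varepsilon,H}_t(x)$ as $t\to\infty$). For $\varepsilon\in(0,1)$ define $t_\varepsilon:=\frac1\lambda\ln\left(\frac1\varepsilon\right)$. Then for any $(w_\varepsilon)_{\varepsilon\in(0,1)}$ such that $w_\varepsilon\to w$ as $\varepsilon\to0^+$ with $w>0$, $$\lim_{\varepsilon\to0^+}\frac1\varepsilon\,\mathcal{W}_p\left(X^{\varepsilon,H}_{t_\varepsilon+r w_\varepsilon}(x),X^{\varepsilon,H}_\infty\right)=\mathcal{P}^H_{\mathcal{W}_p}(r)\quad\text{for every } r\in\mathbb{R},$$ where $$\mathcal{P}^H_{\mathcal{W}_p}(r):=\mathcal{W}_p\left(\mathcal{N}(e^{-\lambda r w}x,\mathcal{R}),\,\mathcal{N}(0,\mathcal{R})\right),\quad r\in\mathbb{R}.$$ In addition,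 if $x\neq 0$, then $\lim_{r\to-\infty}\mathcal{P}^H_{\mathcal{W}_p}(r)=\infty$ and $\lim_{r\to\infty}\mathcal{P}^H_{\mathcal{W}_p}(r)=0$.
   Context: $\mathcal{W}_p(X_1,X_2)=\inf_\nu\left(\int|u_1-u_2|^p\,\nu(\mathrm{d}u_1,\mathrm{d}u_2)\right)^{1/p}$, the infimum being over all couplings $\nu$ of the laws of $X_1$ and $X_2$ (Wasserstein distance of order $p$, for laws with finite absolute $p$-th moment). $\mathcal{N}(a,s^2)$ is the normal law with mean $a$ and variance $s^2>0$; $\Gamma$ is the Gamma function. Fractional Brownian motion with Hurst exponent $H$ is the continuous centered Gaussian process started at $0$ with $\mathbb{E}[B^H_sB^H_t]=\frac12(t^{2H}+s^{2H}-|t-s|^{2H})$. The solution of the equation is given path-wise by $X^{\varepsilon,H}_t(x)=e^{-\lambda t}x+\varepsilon e^{-\lambda t}\int_0^t e^{\lambda s}\,\mathrm{d}B^H_s$, where the integral is defined by integration by parts: $\int_0^t e^{\lambda s}\,\mathrm{d}B^H_s=e^{\lambda t}B^H_t-\lambda\int_0^t e^{\lambda s}B^H_s\,\mathrm{d}s$. *)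

theory Defs
  imports "HOL-Probability.Probability"
begin

definition normal_law :: "real \<Rightarrow> real \<Rightarrow> real measure" where
  "normal_law a v = density lborel (\<lambda>u. ennreal (normal_density a (sqrt v) u))"
  (* v is the variance, whereas normal_density takes the standard deviation *)

definition gaussian_law :: "real measure \<Rightarrow> bool" where
  "gaussian_law \<mu> \<longleftrightarrow> (\<exists>a v. 0 < v \<and> \<mu> = normal_law a v) \<or> (\<exists>a. \<mu> = return borel a)"
  (* point masses are the degenerate normal laws *)

definition couplings :: "real measure \<Rightarrow> real measure \<Rightarrow> (real \<times> real) measure set" where
  "couplings \<mu> \<mu>' = {\<nu>. prob_space \<nu> \<and> sets \<nu> = sets (borel \<Otimes>\<^sub>M borel) \<and>
     distr \<nu> borel fst = \<mu> \<and> distr \<nu> borel snd = \<mu>'}"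

definition wasserstein :: "real \<Rightarrow> real measure \<Rightarrow> real measure \<Rightarrow> real" where
  "wasserstein p \<mu> \<mu>' =
     (INF \<nu>\<in>couplings \<mu> \<mu>'. (\<integral>u. \<bar>fst u - snd u\<bar> powr p \<partial>\<nu>) powr (1 / p))"

text \<open>The Bochner integral is \<open>0\<close> for a non-integrable function. The following lemma shows that
  this does not affect \<^const>\<open>wasserstein\<close> at laws with finite absolute \<open>p\<close>-th moment, which is
  where it is meant to be used.\<close>

lemma integrable_coupling_cost:
  assumes p: "1 \<le> p" and \<nu>: "\<nu> \<in> couplings \<mu> \<mu>'"
    and m: "integrable \<mu> (\<lambda>u. \<bar>u\<bar> powr p)" "integrable \<mu>' (\<lambda>u. \<bar>u\<bar> powr p)"
  shows "integrable \<nu> (\<lambda>u. \<bar>fst u - snd u\<bar> powr p)"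
proof -
  have s[measurable_cong]: "sets \<nu> = sets (borel \<Otimes>\<^sub>M borel)"
    and d: "distr \<nu> borel fst = \<mu>" "distr \<nu> borel snd = \<mu>'"
    using \<nu> by (auto simp: couplings_def)
  have 1: "integrable \<nu> (\<lambda>u. \<bar>fst u\<bar> powr p)"
    using m(1) unfolding d(1)[symmetric] by (rule integrable_distr[rotated]) measurable
  have 2: "integrable \<nu> (\<lambda>u. \<bar>snd u\<bar> powr p)"
    using m(2) unfolding d(2)[symmetric] by (rule integrable_distr[rotated]) measurable
  have bound: "\<bar>a - b\<bar> powr p \<le> 2 powr p * (\<bar>a\<bar> powr p + \<bar>b\<bar> powr p)" for a b :: real
  proof -
    have "\<bar>a - b\<bar> powr p \<le> (2 * max \<bar>a\<bar> \<bar>b\<bar>) powr p"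
      by (rule powr_mono2) (use p in auto)
    also have "\<dots> = 2 powr p * max \<bar>a\<bar> \<bar>b\<bar> powr p"
      by (simp add: powr_mult)
    also have "\<dots> \<le> 2 powr p * (\<bar>a\<bar> powr p + \<bar>b\<bar> powr p)"
      by (rule mult_left_mono) (auto simp: max_def)
    finally show ?thesis .
  qed
  show ?thesis
    by (rule Bochner_Integration.integrable_bound[where f = "\<lambda>u. 2 powr p * (\<bar>fst u\<bar> powr p + \<bar>snd u\<bar> powr p)"])
      (use 1 2 bound in \<open>auto intro!: AE_I2\<close>)
qed

definition gaussian_process :: "'a measure \<Rightarrow> (real \<Rightarrow> 'a \<Rightarrow> real) \<Rightarrow> bool" where
  "gaussian_process M B \<longleftrightarrow>
     (\<forall>t\<ge>0. B t \<in> borel_measurable M) \<and>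
     (\<forall>F c. finite F \<and> F \<subseteq> {0..} \<longrightarrow> gaussian_law (distr M borel (\<lambda>\<omega>. \<Sum>t\<in>F. c t * B t \<omega>)))"

definition fractional_brownian_motion ::
    "real \<Rightarrow> 'a measure \<Rightarrow> (real \<Rightarrow> 'a \<Rightarrow> real) \<Rightarrow> bool" where
  "fractional_brownian_motion H M B \<longleftrightarrow>
     prob_space M \<and> gaussian_process M B \<and>
     (\<forall>\<omega>\<in>space M. B 0 \<omega> = 0 \<and> continuous_on {0..} (\<lambda>t. B t \<omega>)) \<and>
     (\<forall>t\<ge>0. (\<integral>\<omega>. B t \<omega> \<partial>M) = 0) \<and>
     (\<forall>s\<ge>0. \<forall>t\<ge>0. (\<integral>\<omega>. B s \<omega> * B t \<omega> \<partial>M) =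
        (t powr (2 * H) + s powr (2 * H) - \<bar>t - s\<bar> powr (2 * H)) / 2)"

(* \<integral>_0^t e^{lam s} db(s) along a continuous path b, by integration by parts *)
definition exp_path_integral :: "real \<Rightarrow> (real \<Rightarrow> real) \<Rightarrow> real \<Rightarrow> real" where
  "exp_path_integral lam b t =
     exp (lam * t) * b t - lam * integral {0..t} (\<lambda>s. exp (lam * s) * b s)"

definition fractional_OU ::
    "real \<Rightarrow> (real \<Rightarrow> 'a \<Rightarrow> real) \<Rightarrow> real \<Rightarrow> real \<Rightarrow> real \<Rightarrow> 'a \<Rightarrow> real" where
  "fractional_OU lam B x \<epsilon> t \<omega> =
     exp (- lam * t) * x + \<epsilon> * exp (- lam * t) * exp_path_integral lam (\<lambda>s. B s \<omega>) t"

definition limit_variance :: "real \<Rightarrow> real \<Rightarrow> real" where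
  "limit_variance H lam = lam powr (- 2 * H) * Gamma (2 * H + 1) / 2"

definition cutoff_time :: "real \<Rightarrow> real \<Rightarrow> real" where
  "cutoff_time lam \<epsilon> = 1 / lam * ln (1 / \<epsilon>)"

definition cutoff_profile :: "real \<Rightarrow> real \<Rightarrow> real \<Rightarrow> real \<Rightarrow> real \<Rightarrow> real \<Rightarrow> real" where
  "cutoff_profile H lam x p w r =
     wasserstein p (normal_law (exp (- lam * r * w) * x) (limit_variance H lam))
                   (normal_law 0 (limit_variance H lam))"

end

theory Submission
  imports Defs "HOL-Real_Asymp.Real_Asymp"
begin

text \<open>
  Let \<open>Y\<^sub>t = e\<^bsup>-\<lambda>t\<^esup> \<integral>\<^sub>0\<^sup>t e\<^bsup>\<lambda>s\<^esup> dB\<^sub>s\<close>. Reversing time, the integration by parts formula becomes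
  \<open>Y\<^sub>t = \<E>\<^sub>A[D(min A t)]\<close> path by path, where \<open>D(a) = B\<^sub>t - B(t - a)\<close> and \<open>\<E>\<^sub>A\<close> averages over an
  exponential time \<open>A\<close> of rate \<open>\<lambda>\<close>. Since \<open>D\<close> has the covariance \<open>K\<close> of \<open>B\<close>, discretising \<open>A\<close> exhibits \<open>Y\<^sub>t\<close>
  as a limit of centred Gaussians with variance tending to \<open>\<E>[K(min A t, min A' t)]\<close>, \<open>A'\<close> an
  independent copy of \<open>A\<close>; so \<open>Y\<^sub>t\<close> is a centred Gaussian with this variance. As \<open>t \<rightarrow> \<infinity>\<close> the
  variance tends to \<open>\<E>[K(A, A')]\<close>, and because \<open>\<bar>A - A'\<bar>\<close> is again exponential of rate \<open>\<lambda>\<close>, this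
  is \<open>\<E>[A\<^bsup>2H\<^esup>] / 2 = \<R>\<close>.

  The distance between two normal laws is at least the difference of their means (Jensen), and at
  most the cost of the coupling that uses one standard normal variable for both. For equal
  variances the two bounds agree, so the profile is \<open>e\<^bsup>-\<lambda>rw\<^esup> \<bar>x\<bar>\<close>; for variances that merge in the
  limit they agree asymptotically. The cutoff time is chosen so that \<open>e\<^bsup>-\<lambda>t\<^esup> = \<epsilon>\<close>.
\<close>

section \<open>Wasserstein distance of normal laws\<close>

text \<open>Convexity of y^p puts the tangent at 1 below the graph. The point 0 is treated apart
  because convexity is used on the open half-line; there the claim reads 1 - p \<le> 0.\<close>

lemma powr_tangent_at_1:
  fixes p y :: real
  assumes "1 \<le> p" "0 \<le> y"
  shows "1 + p * (y - 1) \<le> y powr p"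
proof (cases "y = 0")
  case False
  have "((\<lambda>y. y powr p) has_field_derivative p * 1 powr (p - 1)) (at 1)"
    by (rule has_real_derivative_powr) simp
  then have "((\<lambda>y. y powr p) has_field_derivative p) (at 1 within {0<..})"
    by (simp add: has_field_derivative_at_within)
  from convex_on_imp_above_tangent[OF powr_convex[OF assms(1)] _ _ _ this, of y]
  have "p * (y - 1) \<le> y powr p - 1 powr p"
    using assms False by (simp add: interior_open)
  then show ?thesis by simp
qed (use assms in auto)

text \<open>Jensen's inequality for y^p, proved by integrating a tangent line. Rescaled to touch the
  graph at c = E|X|, the tangent has a linear term of mean zero, so integration leaves c^p \<le>
  E|X|^p.\<close>

lemma (in prob_space) abs_expectation_le_Lp_norm:
  fixes X :: "'a \<Rightarrow> real"
  assumes p: "1 \<le> p" and X: "integrable M X" "integrable M (\<lambda>\<omega>. \<bar>X \<omega>\<bar> powr p)"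
  shows "\<bar>expectation X\<bar> \<le> (expectation (\<lambda>\<omega>. \<bar>X \<omega>\<bar> powr p)) powr (1 / p)"
proof -
  define c where "c = expectation (\<lambda>\<omega>. \<bar>X \<omega>\<bar>)"
  have "c \<le> (expectation (\<lambda>\<omega>. \<bar>X \<omega>\<bar> powr p)) powr (1 / p)"
  \<comment> \<open>The rescaling divides by \<open>c\<close>; otherwise \<open>c\<close> \<le> 0
    and the right side is nonnegative.\<close>
  proof (cases "c > 0")
    case True
    have tangent: "c powr p * (1 + p * (\<bar>X \<omega>\<bar> / c - 1)) \<le> \<bar>X \<omega>\<bar> powr p" for \<omega>
    proof -
      have "c powr p * (1 + p * (\<bar>X \<omega>\<bar> / c - 1)) \<le> c powr p * (\<bar>X \<omega>\<bar> / c) powr p"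
        using True p by (intro mult_left_mono[OF powr_tangent_at_1]) auto
      also have "\<dots> = \<bar>X \<omega>\<bar> powr p"
        using True by (simp add: powr_mult[symmetric])
      finally show ?thesis .
    qed
    have "c powr p = expectation (\<lambda>\<omega>. c powr p * (1 + p * (\<bar>X \<omega>\<bar> / c - 1)))"
      using X True by (simp add: prob_space c_def)
    also have "\<dots> \<le> expectation (\<lambda>\<omega>. \<bar>X \<omega>\<bar> powr p)"
      using X tangent by (intro integral_mono) auto
    finally have "(c powr p) powr (1 / p) \<le> (expectation (\<lambda>\<omega>. \<bar>X \<omega>\<bar> powr p)) powr (1 / p)"
      using p by (intro powr_mono2) auto
    then show ?thesis
      using True p by (simp add: powr_powr)
  qed (auto intro: order_trans[of _ 0])
  then show ?thesis
    using integral_norm_bound[of M X] unfolding real_norm_def c_def by linarith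
qed

text \<open>Under every coupling fst u - snd u has the same mean, the difference of the two means,
  so Jensen bounds every cost from below at once. Nonemptiness enters because the real infimum of an
  empty set carries no information.\<close>

lemma wasserstein_ge_mean_diff:
  assumes p: "1 \<le> p" and ne: "couplings \<mu> \<mu>' \<noteq> {}"
    and m: "integrable \<mu> (\<lambda>u. \<bar>u\<bar> powr p)" "integrable \<mu>' (\<lambda>u. \<bar>u\<bar> powr p)"
    and i: "integrable \<mu> (\<lambda>u. u)" "integrable \<mu>' (\<lambda>u. u)"
  shows "\<bar>(\<integral>u. u \<partial>\<mu>) - (\<integral>u. u \<partial>\<mu>')\<bar> \<le> wasserstein p \<mu> \<mu>'"
  unfolding wasserstein_def
proof (rule cINF_greatest[OF ne])
  fix \<nu> assume \<nu>: "\<nu> \<in> couplings \<mu> \<mu>'"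
  then have s[measurable_cong]: "sets \<nu> = sets (borel \<Otimes>\<^sub>M borel)"
    and d: "distr \<nu> borel fst = \<mu>" "distr \<nu> borel snd = \<mu>'" and "prob_space \<nu>"
    by (auto simp: couplings_def)
  interpret prob_space \<nu> by fact
  have 1: "integrable \<nu> fst"
    using i(1) unfolding d(1)[symmetric] by (rule integrable_distr[rotated]) measurable
  have 2: "integrable \<nu> snd"
    using i(2) unfolding d(2)[symmetric] by (rule integrable_distr[rotated]) measurable
  have "(\<integral>u. u \<partial>\<mu>) - (\<integral>u. u \<partial>\<mu>') = (\<integral>u. fst u - snd u \<partial>\<nu>)"
    using 1 2 unfolding d[symmetric] by (simp add: integral_distr)
  then show "\<bar>(\<integral>u. u \<partial>\<mu>) - (\<integral>u. u \<partial>\<mu>')\<bar> \<le> (\<integral>u. \<bar>fst u - snd u\<bar> powr p \<partial>\<nu>) powr (1 / p)"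
    using abs_expectation_le_Lp_norm[OF p _ integrable_coupling_cost[OF p \<nu> m]] 1 2 by simp
qed

lemma (in prob_space) distr_pair_in_couplings:
  assumes [measurable]: "X \<in> borel_measurable M" "Y \<in> borel_measurable M"
  shows "distr M (borel \<Otimes>\<^sub>M borel) (\<lambda>\<omega>. (X \<omega>, Y \<omega>)) \<in> couplings (distr M borel X) (distr M borel Y)"
  by (auto simp: couplings_def distr_distr comp_def intro!: prob_space_distr)

text \<open>The joint law of \<open>X\<close> and \<open>Y\<close> is an admissible coupling; all
  costs are at least 0, which gives the lower boundedness that a real infimum requires.\<close>

lemma (in prob_space) wasserstein_le_Lp_norm_diff:
  assumes [measurable]: "X \<in> borel_measurable M" "Y \<in> borel_measurable M"
  shows "wasserstein p (distr M borel X) (distr M borel Y)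
    \<le> (\<integral>\<omega>. \<bar>X \<omega> - Y \<omega>\<bar> powr p \<partial>M) powr (1 / p)"
proof -
  have "wasserstein p (distr M borel X) (distr M borel Y)
    \<le> (\<integral>u. \<bar>fst u - snd u\<bar> powr p \<partial>distr M (borel \<Otimes>\<^sub>M borel) (\<lambda>\<omega>. (X \<omega>, Y \<omega>))) powr (1 / p)"
    unfolding wasserstein_def
    by (rule cINF_lower[OF _ distr_pair_in_couplings]) (auto intro!: bdd_belowI[of _ 0])
  then show ?thesis
    by (simp add: integral_distr)
qed

section \<open>Normal laws as affine images of one standard normal variable\<close>

abbreviation "\<gamma> \<equiv> std_normal_distribution"

lemma prob_space_std_normal: "prob_space \<gamma>"
  using real_dist_normal_dist by (simp add: real_distribution_def)

lemma distr_std_normal_affine: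
  assumes "0 < \<sigma>"
  shows "distr \<gamma> borel (\<lambda>z. a + \<sigma> * z) = density lborel (normal_density a \<sigma>)"
proof -
  interpret prob_space \<gamma> by (rule prob_space_std_normal)
  have "distributed \<gamma> lborel (\<lambda>z. z) (normal_density 0 1)"
    by (simp add: distributed_def distr_id2)
  from normal_density_affine[OF this, of \<sigma> a] assms
  have "distributed \<gamma> lborel (\<lambda>z. a + \<sigma> * z) (normal_density a \<sigma>)" by simp
  then show ?thesis
    by (simp add: distributed_def cong: distr_cong)
qed

text \<open>Placing all normal laws on the one space \<gamma> lets any two of them be coupled
  through the same z. Slope 0 gives a point mass, so degenerate laws fit the same affine
  form.\<close>

lemma normal_law_eq_distr:
  assumes "0 < v"
  shows "normal_law a v = distr \<gamma> borel (\<lambda>z. a + sqrt v * z)"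
  using distr_std_normal_affine[of "sqrt v" a] assms by (simp add: normal_law_def)

lemma integrable_std_normal_abs_affine_powr:
  assumes "0 \<le> p"
  shows "integrable \<gamma> (\<lambda>z. \<bar>a + s * z\<bar> powr p)"
proof -
  \<comment> \<open>An exponent 2k \<ge> p is wanted: an even power needs no absolute value and
    expands by the binomial theorem into moments of the standard normal law.\<close>
  define k where "k = nat \<lceil>p\<rceil>"
  have k: "p \<le> real (2 * k)" using assms by (simp add: k_def) linarith
  have "\<bar>a + s * z\<bar> powr p \<le> 1 + (a + s * z) ^ (2 * k)" for z
  proof (cases "\<bar>a + s * z\<bar> \<le> 1")
    case True
    then have "\<bar>a + s * z\<bar> powr p \<le> 1 powr p" using assms by (intro powr_mono2) auto
    then show ?thesis by (simp add: power_mult add_increasing2)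
  next
    case False
    then have "\<bar>a + s * z\<bar> powr p \<le> \<bar>a + s * z\<bar> powr (2 * k)"
      using k by (intro powr_mono) auto
    also have "\<dots> = \<bar>a + s * z\<bar> ^ (2 * k)"
      using False by (subst powr_realpow[symmetric]) auto
    also have "\<dots> = (a + s * z) ^ (2 * k)" by (simp add: power_even_abs)
    finally show ?thesis by simp
  qed
  then have bound: "norm (\<bar>a + s * z\<bar> powr p) \<le> norm (1 + (a + s * z) ^ (2 * k))" for z
    by (simp add: abs_of_nonneg order_trans[OF powr_ge_zero])
  have "integrable \<gamma> (\<lambda>z. 1 + (a + s * z) ^ (2 * k))"
  proof -
    interpret prob_space \<gamma> by (rule prob_space_std_normal)
    show ?thesis
      unfolding binomial_ring
      by (auto simp: power_mult_distrib intro!: Bochner_Integration.integrable_add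
          Bochner_Integration.integrable_sum integrable_mult_right integrable_mult_left
          integrable_std_normal_distribution_moment)
  qed
  from this _ AE_I2[OF bound] show ?thesis
    by (rule Bochner_Integration.integrable_bound) measurable
qed

lemma integral_std_normal_affine:
  "integrable \<gamma> (\<lambda>z. a + s * z)" "(\<integral>z. a + s * z \<partial>\<gamma>) = a"
proof -
  interpret prob_space \<gamma> by (rule prob_space_std_normal)
  have 1: "integrable \<gamma> (\<lambda>z. z)"
    using integrable_std_normal_distribution_moment[of 1] by simp
  have "(\<integral>z. z \<partial>\<gamma>) = 0"
    using integral_std_normal_distribution_moment_odd[of 1] by simp
  then show "integrable \<gamma> (\<lambda>z. a + s * z)" "(\<integral>z. a + s * z \<partial>\<gamma>) = a"
    using 1 prob_space by auto
qed

text \<open>Dominated convergence along sequences of parameters, which are bounded by some C. Since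
  |a + s z| \<le> C + C|z| = max |C + C z| |C - C z| for C \<ge> 0, the sum of the two p-th powers
  dominates, and each is integrable by the affine moment bound.\<close>

lemma isCont_std_normal_Lp_norm_affine:
  assumes p: "1 \<le> p"
  shows "isCont (\<lambda>(a, s). (\<integral>z. \<bar>a + s * z\<bar> powr p \<partial>\<gamma>)) (a0, s0)"
  unfolding continuous_at_sequentially
proof (intro allI impI)
  fix X :: "nat \<Rightarrow> real \<times> real" assume X: "X \<longlonglongrightarrow> (a0, s0)"
  have X1: "(\<lambda>n. fst (X n)) \<longlonglongrightarrow> a0" and X2: "(\<lambda>n. snd (X n)) \<longlonglongrightarrow> s0"
    using tendsto_fst[OF X] tendsto_snd[OF X] by auto
  obtain C where C: "\<And>n. norm (X n) \<le> C"
    using convergent_imp_Bseq[OF convergentI[OF X]] by (auto simp: Bseq_def)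
  have "(\<lambda>n. \<integral>z. \<bar>fst (X n) + snd (X n) * z\<bar> powr p \<partial>\<gamma>) \<longlonglongrightarrow> (\<integral>z. \<bar>a0 + s0 * z\<bar> powr p \<partial>\<gamma>)"
  proof (rule integral_dominated_convergence[where w="\<lambda>z. \<bar>C + C * z\<bar> powr p + \<bar>C + (- C) * z\<bar> powr p"])
    show "integrable \<gamma> (\<lambda>z. \<bar>C + C * z\<bar> powr p + \<bar>C + (- C) * z\<bar> powr p)"
      using p by (intro Bochner_Integration.integrable_add integrable_std_normal_abs_affine_powr) auto
    show "AE z in \<gamma>. (\<lambda>n. \<bar>fst (X n) + snd (X n) * z\<bar> powr p) \<longlonglongrightarrow> \<bar>a0 + s0 * z\<bar> powr p"
    proof (rule AE_I2, rule tendsto_powr'[OF _ tendsto_const])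
      show "(\<lambda>n. \<bar>fst (X n) + snd (X n) * z\<bar>) \<longlonglongrightarrow> \<bar>a0 + s0 * z\<bar>" for z
        by (intro tendsto_intros X1 X2)
    qed (use p in auto)
    show "AE z in \<gamma>. norm (\<bar>fst (X n) + snd (X n) * z\<bar> powr p)
        \<le> \<bar>C + C * z\<bar> powr p + \<bar>C + (- C) * z\<bar> powr p" for n
    proof (rule AE_I2)
      fix z
      have "\<bar>fst (X n)\<bar> \<le> C" "\<bar>snd (X n)\<bar> \<le> C"
        using C[of n] norm_fst_le[of "fst (X n)" "snd (X n)"] norm_snd_le[of "snd (X n)" "fst (X n)"]
        by simp_all
      then have "\<bar>fst (X n) + snd (X n) * z\<bar> \<le> C + C * \<bar>z\<bar>"
        by (intro order_trans[OF abs_triangle_ineq] add_mono) (auto simp: abs_mult intro!: mult_right_mono)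
      also have "\<dots> \<le> max \<bar>C + C * z\<bar> \<bar>C + (- C) * z\<bar>"
        by (cases "z \<ge> 0") auto
      finally have "\<bar>fst (X n) + snd (X n) * z\<bar> powr p \<le> \<dots> powr p"
        using p by (intro powr_mono2) auto
      also have "\<dots> \<le> \<bar>C + C * z\<bar> powr p + \<bar>C + (- C) * z\<bar> powr p"
        by (simp only: max_def) simp
      finally show "norm (\<bar>fst (X n) + snd (X n) * z\<bar> powr p)
        \<le> \<bar>C + C * z\<bar> powr p + \<bar>C + (- C) * z\<bar> powr p"
        by (simp only: real_norm_def abs_of_nonneg powr_ge_zero)
    qed
  qed auto
  then show "((\<lambda>(a, s). \<integral>z. \<bar>a + s * z\<bar> powr p \<partial>\<gamma>) \<circ> X) \<longlonglongrightarrow> (case (a0, s0) of (a, s) \<Rightarrow> \<integral>z. \<bar>a + s * z\<bar> powr p \<partial>\<gamma>)"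
    by (simp add: comp_def case_prod_beta)
qed

section \<open>Two-sided bounds for normal laws and their scaling limit\<close>

lemma wasserstein_std_normal_affine_bounds:
  fixes a b s s' :: real
  assumes p: "1 \<le> p"
  shows "\<bar>a - b\<bar> \<le> wasserstein p (distr \<gamma> borel (\<lambda>z. a + s * z)) (distr \<gamma> borel (\<lambda>z. b + s' * z))" (is ?L)
    and "wasserstein p (distr \<gamma> borel (\<lambda>z. a + s * z)) (distr \<gamma> borel (\<lambda>z. b + s' * z))
      \<le> (\<integral>z. \<bar>(a - b) + (s - s') * z\<bar> powr p \<partial>\<gamma>) powr (1 / p)" (is ?U)
proof -
  interpret prob_space \<gamma> by (rule prob_space_std_normal)
  \<comment> \<open>The coupling through the common z, which also yields the upper bound.\<close>
  have ne: "couplings (distr \<gamma> borel (\<lambda>z. a + s * z)) (distr \<gamma> borel (\<lambda>z. b + s' * z)) \<noteq> {}"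
    using distr_pair_in_couplings[of "\<lambda>z. a + s * z" "\<lambda>z. b + s' * z"] by auto
  have i: "integrable (distr \<gamma> borel (\<lambda>z. a + s * z)) (\<lambda>u. \<bar>u\<bar> powr p)"
    "integrable (distr \<gamma> borel (\<lambda>z. a + s * z)) (\<lambda>u. u)"
    "(\<integral>u. u \<partial>distr \<gamma> borel (\<lambda>z. a + s * z)) = a" for a s
    using p integrable_std_normal_abs_affine_powr[of p a s] integral_std_normal_affine[of a s]
    by (subst integrable_distr_eq integral_distr; simp)+
  show ?L
    using wasserstein_ge_mean_diff[OF p ne i(1) i(1) i(2) i(2)] by (simp only: i(3))
  show ?U
    using wasserstein_le_Lp_norm_diff[of "\<lambda>z. a + s * z" "\<lambda>z. b + s' * z" p]
    by (simp add: algebra_simps)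
qed

lemma wasserstein_normal_law_same_variance:
  assumes p: "1 \<le> p" and v: "0 < v"
  shows "wasserstein p (normal_law a v) (normal_law b v) = \<bar>a - b\<bar>"
proof -
  interpret prob_space \<gamma> by (rule prob_space_std_normal)
  have "(\<integral>z. \<bar>(a - b) + (sqrt v - sqrt v) * z\<bar> powr p \<partial>\<gamma>) powr (1 / p) = \<bar>a - b\<bar>"
    using p prob_space by (simp add: powr_powr)
  then show ?thesis
    using wasserstein_std_normal_affine_bounds[OF p, where a = a and b = b and s = "sqrt v" and s' = "sqrt v"] v
    by (simp only: normal_law_eq_distr order_antisym_conv)
qed

text \<open>Both laws carry the factor \<epsilon>, which 1 / \<epsilon> cancels. The rescaled
  distance lies between |a n| and the L^p norm of a n + (s n - s0) z; continuity of that norm at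
  (a0, 0) makes both bounds tend to |a0|.\<close>

lemma tendsto_scaled_wasserstein_normal:
  assumes p: "1 \<le> p" and \<epsilon>: "eventually (\<lambda>n. 0 < \<epsilon> n) F"
    and a: "(a \<longlongrightarrow> a0) F" and s: "(s \<longlongrightarrow> s0) F"
  shows "((\<lambda>n. 1 / \<epsilon> n * wasserstein p (distr \<gamma> borel (\<lambda>z. \<epsilon> n * a n + \<epsilon> n * s n * z))
            (distr \<gamma> borel (\<lambda>z. 0 + \<epsilon> n * s0 * z))) \<longlongrightarrow> \<bar>a0\<bar>) F"
proof (rule tendsto_sandwich)
  interpret prob_space \<gamma> by (rule prob_space_std_normal)
  let ?W = "\<lambda>n. 1 / \<epsilon> n * wasserstein p (distr \<gamma> borel (\<lambda>z. \<epsilon> n * a n + \<epsilon> n * s n * z))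
            (distr \<gamma> borel (\<lambda>z. 0 + \<epsilon> n * s0 * z))"
  let ?U = "\<lambda>n. (\<integral>z. \<bar>a n + (s n - s0) * z\<bar> powr p \<partial>\<gamma>) powr (1 / p)"
  show "((\<lambda>n. \<bar>a n\<bar>) \<longlongrightarrow> \<bar>a0\<bar>) F" by (intro tendsto_intros a)
  show "eventually (\<lambda>n. \<bar>a n\<bar> \<le> ?W n) F"
    using \<epsilon>
  proof eventually_elim
    case (elim n)
    then show ?case
      using wasserstein_std_normal_affine_bounds(1)[OF p, of "\<epsilon> n * a n" 0 "\<epsilon> n * s n" "\<epsilon> n * s0"]
      by (simp add: abs_mult field_simps)
  qed
  show "eventually (\<lambda>n. ?W n \<le> ?U n) F"
    using \<epsilon>
  proof eventually_elim
    case (elim n)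
    \<comment> \<open>The factor \<open>\<epsilon> n powr p\<close> leaves the integral and becomes
      \<open>\<epsilon> n\<close> after taking the p-th root.\<close>
    have "(\<integral>z. \<bar>(\<epsilon> n * a n - 0) + (\<epsilon> n * s n - \<epsilon> n * s0) * z\<bar> powr p \<partial>\<gamma>)
        = (\<integral>z. \<epsilon> n powr p * \<bar>a n + (s n - s0) * z\<bar> powr p \<partial>\<gamma>)"
    proof (rule Bochner_Integration.integral_cong[OF refl])
      fix z
      have "(\<epsilon> n * a n - 0) + (\<epsilon> n * s n - \<epsilon> n * s0) * z = \<epsilon> n * (a n + (s n - s0) * z)"
        by (simp add: algebra_simps)
      then show "\<bar>(\<epsilon> n * a n - 0) + (\<epsilon> n * s n - \<epsilon> n * s0) * z\<bar> powr p
          = \<epsilon> n powr p * \<bar>a n + (s n - s0) * z\<bar> powr p"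
        using elim by (simp add: abs_mult powr_mult)
    qed
    then have "(\<integral>z. \<bar>(\<epsilon> n * a n - 0) + (\<epsilon> n * s n - \<epsilon> n * s0) * z\<bar> powr p \<partial>\<gamma>) powr (1 / p)
        = \<epsilon> n * ?U n"
      using elim p by (simp add: powr_mult powr_powr)
    then show ?case
      using wasserstein_std_normal_affine_bounds(2)[OF p, of "\<epsilon> n * a n" "\<epsilon> n * s n" 0 "\<epsilon> n * s0"] elim
      by (simp add: divide_le_eq mult.commute)
  qed
  have "((\<lambda>n. (a n, s n - s0)) \<longlongrightarrow> (a0, s0 - s0)) F"
    by (intro tendsto_intros a s)
  from isCont_tendsto_compose[OF isCont_std_normal_Lp_norm_affine[OF p] this]
  have "((\<lambda>n. \<integral>z. \<bar>a n + (s n - s0) * z\<bar> powr p \<partial>\<gamma>) \<longlongrightarrow> \<bar>a0\<bar> powr p) F"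
    using prob_space by simp
  then have "(?U \<longlongrightarrow> (\<bar>a0\<bar> powr p) powr (1 / p)) F"
    using p by (intro tendsto_powr'[OF _ tendsto_const]) auto
  then show "(?U \<longlongrightarrow> \<bar>a0\<bar>) F" using p by (simp add: powr_powr)
qed

section \<open>Averaging the covariance over exponential times\<close>

abbreviation exp_law :: "real \<Rightarrow> real measure" where
  "exp_law lam \<equiv> density lborel (\<lambda>a. ennreal (exponential_density lam a))"

lemma AE_exp_law_nonneg: "AE a in exp_law lam. 0 \<le> a"
  by (subst AE_density) (auto simp: exponential_density_def)

text \<open>Memorylessness: A exceeds b with probability exp (- lam b), and the excess A - b is then
  again exponential of rate lam. Substituting a = b + x / lam leaves Euler's integral for the Gamma
  function.\<close>

lemma nn_integral_exp_law_shifted_powr: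
  fixes b q lam :: real
  assumes lam: "0 < lam" and q: "0 \<le> q" and b: "0 \<le> b"
  shows "(\<integral>\<^sup>+a. ennreal (max 0 (a - b) powr q) \<partial>exp_law lam)
    = ennreal (exp (- lam * b)) * ennreal (lam powr (- q) * Gamma (q + 1))"
proof -
  have "(\<integral>\<^sup>+a. ennreal (max 0 (a - b) powr q) \<partial>exp_law lam)
      = (\<integral>\<^sup>+a. ennreal (exponential_density lam a) * ennreal (max 0 (a - b) powr q) \<partial>lborel)"
    by (subst nn_integral_density) auto
  also have "\<dots> = ennreal (1 / lam) * (\<integral>\<^sup>+x. ennreal (exponential_density lam (b + 1 / lam * x)) *
      ennreal (max 0 (1 / lam * x) powr q) \<partial>lborel)"
    using lam by (subst nn_integral_real_affine[of _ "1 / lam" b]) auto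
  also have "(\<integral>\<^sup>+x. ennreal (exponential_density lam (b + 1 / lam * x)) *
      ennreal (max 0 (1 / lam * x) powr q) \<partial>lborel) =
      (\<integral>\<^sup>+x. ennreal (lam * exp (- lam * b) * lam powr (- q)) *
        ennreal (indicator {0..} x * x powr (q + 1 - 1) / exp x) \<partial>lborel)"
  proof (rule nn_integral_cong)
    fix x :: real
    show "ennreal (exponential_density lam (b + 1 / lam * x)) *
      ennreal (max 0 (1 / lam * x) powr q) =
      ennreal (lam * exp (- lam * b) * lam powr (- q)) *
        ennreal (indicator {0..} x * x powr (q + 1 - 1) / exp x)"
    proof (cases "x < 0")
      \<comment> \<open>Both sides vanish: \<open>0 powr q\<close> is 0 even for q = 0.\<close>
      case True
      then have "max 0 (1 / lam * x) = 0" using lam by (simp add: max_def divide_nonneg_neg field_simps)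
      then show ?thesis using True by simp
    next
      case False
      then have x: "0 \<le> x" "0 \<le> x / lam" using lam by auto
      have "exp (- (b + x / lam) * lam) = exp (- lam * b) / exp x"
        using lam by (simp add: exp_diff[symmetric] field_simps)
      moreover have "(x / lam) powr q = lam powr (- q) * x powr q"
        using lam x by (simp add: powr_divide powr_minus field_simps)
      moreover have "exponential_density lam (b + x / lam) = lam * exp (- (b + x / lam) * lam)"
        using x b by (simp add: exponential_density_def)
      ultimately have "exponential_density lam (b + 1 / lam * x) * max 0 (1 / lam * x) powr q
          = lam * exp (- lam * b) * lam powr (- q) * (x powr (q + 1 - 1) / exp x)"
        using x by simp
      then show ?thesis
        using x lam by (simp add: ennreal_mult[symmetric] exponential_density_nonneg)
    qed
  qed
  also have "\<dots> = ennreal (lam * exp (- lam * b) * lam powr (- q)) * ennreal (Gamma (q + 1))"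
    using q by (subst nn_integral_cmult) (auto simp: Gamma_conv_nn_integral_real)
  finally show ?thesis
    using lam q by (simp add: ennreal_mult[symmetric] mult.assoc Gamma_real_nonneg)
qed

text \<open>For independent copies A and B this is P(A > B). The integrand against the density of
  rate lam is half the density of rate 2 lam.\<close>

lemma nn_integral_exp_law_exp:
  assumes lam: "0 < lam"
  shows "(\<integral>\<^sup>+b. ennreal (exp (- lam * b)) \<partial>exp_law lam) = ennreal (1 / 2)"
proof -
  interpret prob_space "exp_law (2 * lam)"
    using lam by (intro prob_space_exponential_density) simp
  have "(\<integral>\<^sup>+b. ennreal (exp (- lam * b)) \<partial>exp_law lam)
      = (\<integral>\<^sup>+b. ennreal (exponential_density lam b) * ennreal (exp (- lam * b)) \<partial>lborel)"
    by (subst nn_integral_density) auto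
  also have "\<dots> = (\<integral>\<^sup>+b. ennreal (1 / 2) * ennreal (exponential_density (2 * lam) b) \<partial>lborel)"
  proof (rule nn_integral_cong)
    fix b :: real
    have "exponential_density lam b * exp (- lam * b) = 1 / 2 * exponential_density (2 * lam) b"
      by (simp add: exponential_density_def exp_add[symmetric] algebra_simps)
    then show "ennreal (exponential_density lam b) * ennreal (exp (- lam * b))
        = ennreal (1 / 2) * ennreal (exponential_density (2 * lam) b)"
      using lam by (simp only: ennreal_mult[symmetric] exponential_density_nonneg exp_ge_zero
          zero_le_divide_1_iff zero_le_numeral mult_pos_pos zero_less_numeral)
  qed
  also have "\<dots> = ennreal (1 / 2) * emeasure (exp_law (2 * lam)) (space (exp_law (2 * lam)))"
    by (subst nn_integral_cmult) (auto simp: emeasure_density)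
  finally show ?thesis unfolding emeasure_space_1 by simp
qed

context
  fixes lam q :: real
  assumes lam: "0 < lam" and q: "0 \<le> q"
begin

interpretation E: prob_space "exp_law lam"
  by (rule prob_space_exponential_density[OF lam])

interpretation EE: pair_prob_space "exp_law lam" "exp_law lam" ..

lemma nn_integral_exp_law_powr:
  "(\<integral>\<^sup>+a. ennreal (\<bar>a\<bar> powr q) \<partial>exp_law lam) = ennreal (lam powr (- q) * Gamma (q + 1))"
proof -
  have "(\<integral>\<^sup>+a. ennreal (\<bar>a\<bar> powr q) \<partial>exp_law lam) =
      (\<integral>\<^sup>+a. ennreal (max 0 (a - 0) powr q) \<partial>exp_law lam)"
    using AE_exp_law_nonneg[of lam] by (intro nn_integral_cong_AE) (auto elim!: eventually_mono)
  then show ?thesis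
    using nn_integral_exp_law_shifted_powr[OF lam q, of 0] by simp
qed

text \<open>Split by which time is larger. Given B = b, the part with A > b contributes exp (- lam
  b) times the q-th moment by memorylessness; averaging over b halves the moment, and the two
  symmetric parts add up to the whole.\<close>

lemma nn_integral_exp_law_pair_diff_powr:
  "(\<integral>\<^sup>+u. ennreal (\<bar>\<bar>fst u\<bar> - \<bar>snd u\<bar>\<bar> powr q) \<partial>(exp_law lam \<Otimes>\<^sub>M exp_law lam))
    = ennreal (lam powr (- q) * Gamma (q + 1))"
proof -
  let ?m = "ennreal (lam powr (- q) * Gamma (q + 1))"
  let ?f = "\<lambda>a b::real. ennreal (max 0 (a - b) powr q)"
  \<comment> \<open>The term of the wrong sign is \<open>0 powr q\<close>, hence 0 also for q =
    0.\<close>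
  have split: "ennreal (\<bar>\<bar>a\<bar> - \<bar>b\<bar>\<bar> powr q) = ?f a b + ?f b a" if "0 \<le> a" "0 \<le> b" for a b
    using that by (cases a b rule: linorder_cases) (auto simp: max_def)
  have half: "(\<integral>\<^sup>+b. (\<integral>\<^sup>+a. ?f a b \<partial>exp_law lam) \<partial>exp_law lam) = ennreal (1 / 2) * ?m"
  proof -
    have "(\<integral>\<^sup>+b. (\<integral>\<^sup>+a. ?f a b \<partial>exp_law lam) \<partial>exp_law lam)
        = (\<integral>\<^sup>+b. ennreal (exp (- lam * b)) * ?m \<partial>exp_law lam)"
      using AE_exp_law_nonneg[of lam] lam q
      by (intro nn_integral_cong_AE) (auto elim!: eventually_mono simp: nn_integral_exp_law_shifted_powr)
    also have "\<dots> = ennreal (1 / 2) * ?m"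
      using nn_integral_exp_law_exp[OF lam] by (subst nn_integral_multc) auto
    finally show ?thesis .
  qed
  have "(\<integral>\<^sup>+u. ennreal (\<bar>\<bar>fst u\<bar> - \<bar>snd u\<bar>\<bar> powr q) \<partial>(exp_law lam \<Otimes>\<^sub>M exp_law lam))
      = (\<integral>\<^sup>+a. (\<integral>\<^sup>+b. ennreal (\<bar>\<bar>a\<bar> - \<bar>b\<bar>\<bar> powr q) \<partial>exp_law lam) \<partial>exp_law lam)"
    by (subst E.nn_integral_fst[symmetric]) auto
  also have "\<dots> = (\<integral>\<^sup>+a. (\<integral>\<^sup>+b. ?f a b + ?f b a \<partial>exp_law lam) \<partial>exp_law lam)"
  proof (rule nn_integral_cong_AE)
    show "AE a in exp_law lam. (\<integral>\<^sup>+b. ennreal (\<bar>\<bar>a\<bar> - \<bar>b\<bar>\<bar> powr q) \<partial>exp_law lam)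
        = (\<integral>\<^sup>+b. ?f a b + ?f b a \<partial>exp_law lam)"
      using AE_exp_law_nonneg[of lam]
    proof eventually_elim
      case (elim a)
      show ?case
        using AE_exp_law_nonneg[of lam] split[OF elim]
        by (intro nn_integral_cong_AE) (auto elim!: eventually_mono)
    qed
  qed
  also have "\<dots> = (\<integral>\<^sup>+a. (\<integral>\<^sup>+b. ?f a b \<partial>exp_law lam) \<partial>exp_law lam)
      + (\<integral>\<^sup>+a. (\<integral>\<^sup>+b. ?f b a \<partial>exp_law lam) \<partial>exp_law lam)"
    by (subst nn_integral_add[symmetric]) (auto simp: nn_integral_add)
  \<comment> \<open>The second summand is \<open>half\<close> up to renaming bound variables; the
    first needs the two integrals exchanged.\<close>
  also have "(\<integral>\<^sup>+a. (\<integral>\<^sup>+b. ?f a b \<partial>exp_law lam) \<partial>exp_law lam)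
      = (\<integral>\<^sup>+b. (\<integral>\<^sup>+a. ?f a b \<partial>exp_law lam) \<partial>exp_law lam)"
    using EE.Fubini'[of "\<lambda>b a. ?f a b"] by (simp add: split_beta')
  finally have "(\<integral>\<^sup>+u. ennreal (\<bar>\<bar>fst u\<bar> - \<bar>snd u\<bar>\<bar> powr q) \<partial>(exp_law lam \<Otimes>\<^sub>M exp_law lam))
      = ennreal (1 / 2) * ?m + ennreal (1 / 2) * ?m"
    unfolding half .
  also have "\<dots> = (ennreal (1 / 2) + ennreal (1 / 2)) * ?m" by (rule distrib_right[symmetric])
  also have "ennreal (1 / 2) + ennreal (1 / 2) = 1"
    by (subst ennreal_plus[symmetric]) auto
  finally show ?thesis by simp
qed

lemma has_integral_exp_law_pair:
  shows "has_bochner_integral (exp_law lam \<Otimes>\<^sub>M exp_law lam) (\<lambda>u. \<bar>fst u\<bar> powr q) (lam powr (- q) * Gamma (q + 1))"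
    and "has_bochner_integral (exp_law lam \<Otimes>\<^sub>M exp_law lam) (\<lambda>u. \<bar>snd u\<bar> powr q) (lam powr (- q) * Gamma (q + 1))"
    and "has_bochner_integral (exp_law lam \<Otimes>\<^sub>M exp_law lam) (\<lambda>u. \<bar>\<bar>fst u\<bar> - \<bar>snd u\<bar>\<bar> powr q)
      (lam powr (- q) * Gamma (q + 1))"
proof -
  have G: "0 \<le> lam powr (- q) * Gamma (q + 1)" using q by (simp add: Gamma_real_nonneg)
  show "has_bochner_integral (exp_law lam \<Otimes>\<^sub>M exp_law lam) (\<lambda>u. \<bar>fst u\<bar> powr q) (lam powr (- q) * Gamma (q + 1))"
  proof (rule has_bochner_integral_nn_integral[OF _ _ G])
    show "(\<integral>\<^sup>+u. ennreal (\<bar>fst u\<bar> powr q) \<partial>(exp_law lam \<Otimes>\<^sub>M exp_law lam)) = ennreal (lam powr (- q) * Gamma (q + 1))"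
      by (subst E.nn_integral_fst[symmetric]) (auto simp: nn_integral_exp_law_powr E.emeasure_space_1[simplified])
  qed auto
  show "has_bochner_integral (exp_law lam \<Otimes>\<^sub>M exp_law lam) (\<lambda>u. \<bar>snd u\<bar> powr q) (lam powr (- q) * Gamma (q + 1))"
  proof (rule has_bochner_integral_nn_integral[OF _ _ G])
    show "(\<integral>\<^sup>+u. ennreal (\<bar>snd u\<bar> powr q) \<partial>(exp_law lam \<Otimes>\<^sub>M exp_law lam)) = ennreal (lam powr (- q) * Gamma (q + 1))"
      by (subst E.nn_integral_fst[symmetric]) (auto simp: nn_integral_exp_law_powr E.emeasure_space_1[simplified])
  qed auto
  show "has_bochner_integral (exp_law lam \<Otimes>\<^sub>M exp_law lam) (\<lambda>u. \<bar>\<bar>fst u\<bar> - \<bar>snd u\<bar>\<bar> powr q)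
      (lam powr (- q) * Gamma (q + 1))"
    by (rule has_bochner_integral_nn_integral[OF _ _ G nn_integral_exp_law_pair_diff_powr]) auto
qed

end

section \<open>Averages of the covariance of fractional Brownian motion\<close>

definition fbm_cov :: "real \<Rightarrow> real \<Rightarrow> real \<Rightarrow> real" where
  "fbm_cov H s t = (t powr (2 * H) + s powr (2 * H) - \<bar>t - s\<bar> powr (2 * H)) / 2"

lemma borel_measurable_fbm_cov[measurable (raw)]:
  assumes [measurable]: "f \<in> borel_measurable M" "g \<in> borel_measurable M"
  shows "(\<lambda>x. fbm_cov H (f x) (g x)) \<in> borel_measurable M"
  unfolding fbm_cov_def by measurable

text \<open>As |t - s| \<le> max s t, the subtracted power is at most the sum of the other two. The
  bound serves as the majorant in dominated convergence.\<close>

lemma abs_fbm_cov_le: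
  assumes "0 \<le> H" "0 \<le> s" "0 \<le> t"
  shows "\<bar>fbm_cov H s t\<bar> \<le> s powr (2 * H) + t powr (2 * H)"
proof -
  have "\<bar>t - s\<bar> powr (2 * H) \<le> max s t powr (2 * H)"
    using assms by (intro powr_mono2) auto
  also have "\<dots> \<le> s powr (2 * H) + t powr (2 * H)" by (simp add: max_def)
  finally show ?thesis
    using powr_ge_zero[of "\<bar>t - s\<bar>" "2 * H"] powr_ge_zero[of s "2 * H"] powr_ge_zero[of t "2 * H"]
    unfolding fbm_cov_def by (simp only: abs_le_iff) (auto simp: field_simps simp del: powr_ge_zero)
qed

text \<open>All three powers in the covariance have the same mean m, so the average is (m + m - m) /
  2.\<close>

lemma integral_fbm_cov_exp_law:
  assumes H: "0 < H" and lam: "0 < lam"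
  shows "(\<integral>u. fbm_cov H \<bar>fst u\<bar> \<bar>snd u\<bar> \<partial>(exp_law lam \<Otimes>\<^sub>M exp_law lam)) = limit_variance H lam"
proof -
  let ?m = "lam powr (- (2 * H)) * Gamma (2 * H + 1)"
  have q: "0 \<le> 2 * H" using H by simp
  note I = has_integral_exp_law_pair[OF lam q]
  have "\<bar>\<bar>snd u\<bar> - \<bar>fst u\<bar>\<bar> = \<bar>\<bar>fst u\<bar> - \<bar>snd u\<bar>\<bar>" for u :: "real \<times> real" by simp
  then have "has_bochner_integral (exp_law lam \<Otimes>\<^sub>M exp_law lam) (\<lambda>u. fbm_cov H \<bar>fst u\<bar> \<bar>snd u\<bar>) ((?m + ?m - ?m) / 2)"
    unfolding fbm_cov_def
    using has_bochner_integral_divide_zero[OF has_bochner_integral_diff[OF has_bochner_integral_add[OF I(2) I(1)] I(3)], of 2]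
    by (simp only:)
  then show ?thesis
    by (simp add: has_bochner_integral_iff limit_variance_def)
qed

text \<open>Dominated convergence with majorant |a|^(2H) + |a'|^(2H). The general \<phi> serves two
  limits: refining the grid at a fixed time t, and letting the truncation time t tend to
  infinity.\<close>

lemma tendsto_integral_fbm_cov:
  fixes \<phi> :: "nat \<Rightarrow> real \<Rightarrow> real"
  assumes H: "0 < H" and lam: "0 < lam"
    and [measurable]: "\<And>n. \<phi> n \<in> borel_measurable borel" "\<psi> \<in> borel_measurable borel"
    and \<phi>: "\<And>n a. 0 \<le> \<phi> n a" "\<And>n a. \<phi> n a \<le> \<bar>a\<bar>"
    and lim: "\<And>a. (\<lambda>n. \<phi> n a) \<longlonglongrightarrow> \<psi> a"
  shows "(\<lambda>n. \<integral>u. fbm_cov H (\<phi> n (fst u)) (\<phi> n (snd u)) \<partial>(exp_law lam \<Otimes>\<^sub>M exp_law lam))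
    \<longlonglongrightarrow> (\<integral>u. fbm_cov H (\<psi> (fst u)) (\<psi> (snd u)) \<partial>(exp_law lam \<Otimes>\<^sub>M exp_law lam))"
proof (rule integral_dominated_convergence[where w="\<lambda>u. \<bar>fst u\<bar> powr (2 * H) + \<bar>snd u\<bar> powr (2 * H)"])
  have q: "0 \<le> 2 * H" using H by simp
  note I = has_integral_exp_law_pair[OF lam q]
  show "integrable (exp_law lam \<Otimes>\<^sub>M exp_law lam) (\<lambda>u. \<bar>fst u\<bar> powr (2 * H) + \<bar>snd u\<bar> powr (2 * H))"
    using I(1,2) by (auto simp: has_bochner_integral_iff)
  show "AE u in exp_law lam \<Otimes>\<^sub>M exp_law lam. (\<lambda>n. fbm_cov H (\<phi> n (fst u)) (\<phi> n (snd u)))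
      \<longlonglongrightarrow> fbm_cov H (\<psi> (fst u)) (\<psi> (snd u))"
  proof (rule AE_I2)
    fix u :: "real \<times> real"
    have 1: "(\<lambda>n. \<phi> n a powr (2 * H)) \<longlonglongrightarrow> \<psi> a powr (2 * H)" for a
      by (rule tendsto_powr'[OF lim tendsto_const]) (use H \<phi> in auto)
    have 2: "(\<lambda>n. \<bar>\<phi> n (snd u) - \<phi> n (fst u)\<bar> powr (2 * H)) \<longlonglongrightarrow> \<bar>\<psi> (snd u) - \<psi> (fst u)\<bar> powr (2 * H)"
      by (rule tendsto_powr'[OF tendsto_rabs[OF tendsto_diff[OF lim lim]] tendsto_const]) (use H in auto)
    show "(\<lambda>n. fbm_cov H (\<phi> n (fst u)) (\<phi> n (snd u))) \<longlonglongrightarrow> fbm_cov H (\<psi> (fst u)) (\<psi> (snd u))"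
      unfolding fbm_cov_def by (rule tendsto_divide[OF tendsto_diff[OF tendsto_add[OF 1 1] 2] tendsto_const]) simp
  qed
  show "AE u in exp_law lam \<Otimes>\<^sub>M exp_law lam. norm (fbm_cov H (\<phi> n (fst u)) (\<phi> n (snd u)))
      \<le> \<bar>fst u\<bar> powr (2 * H) + \<bar>snd u\<bar> powr (2 * H)" for n
  proof (rule AE_I2)
    fix u :: "real \<times> real"
    have "\<bar>fbm_cov H (\<phi> n (fst u)) (\<phi> n (snd u))\<bar> \<le> \<phi> n (fst u) powr (2 * H) + \<phi> n (snd u) powr (2 * H)"
      using H \<phi> by (intro abs_fbm_cov_le) auto
    also have "\<dots> \<le> \<bar>fst u\<bar> powr (2 * H) + \<bar>snd u\<bar> powr (2 * H)"
      using q \<phi> by (intro add_mono powr_mono2) auto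
    finally show "norm (fbm_cov H (\<phi> n (fst u)) (\<phi> n (snd u))) \<le> \<bar>fst u\<bar> powr (2 * H) + \<bar>snd u\<bar> powr (2 * H)"
      by simp
  qed
qed measurable

section \<open>Limits of Gaussian variables\<close>

lemma gaussian_law_eq_distr_std_normal:
  assumes "gaussian_law \<mu>"
  obtains a s where "\<mu> = distr \<gamma> borel (\<lambda>z. a + s * z)"
  using assms unfolding gaussian_law_def
proof (elim disjE exE conjE)
  fix a v assume v: "0 < v" "\<mu> = normal_law a v"
  show thesis using v by (intro that[of a "sqrt v"]) (simp add: normal_law_eq_distr)
next
  fix a assume a: "\<mu> = return borel a"
  interpret prob_space \<gamma> by (rule prob_space_std_normal)
  have "distr \<gamma> borel (\<lambda>z. a + 0 * z) = return borel a"
    by (simp add: distr_const)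
  then show thesis using a by (intro that[of a 0]) simp
qed

lemma integral_std_normal_affine_square:
  "integrable \<gamma> (\<lambda>z. (a + s * z)\<^sup>2)" "(\<integral>z. (a + s * z)\<^sup>2 \<partial>\<gamma>) = a\<^sup>2 + s\<^sup>2"
proof -
  interpret prob_space \<gamma> by (rule prob_space_std_normal)
  have [simp]: "integrable \<gamma> (\<lambda>z. z)" "(\<integral>z. z \<partial>\<gamma>) = 0"
    using integral_std_normal_affine[of 0 1] by simp_all
  have [simp]: "integrable \<gamma> (\<lambda>z. z\<^sup>2)" "(\<integral>z. z\<^sup>2 \<partial>\<gamma>) = 1"
    using integrable_std_normal_distribution_moment[of 2] std_normal_distribution_even_moments[of 1]
    by (simp_all add: eval_nat_numeral)
  have eq: "(a + s * z)\<^sup>2 = a\<^sup>2 + (2 * a * s) * z + s\<^sup>2 * z\<^sup>2" for z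
    by (simp add: power2_eq_square algebra_simps)
  show "integrable \<gamma> (\<lambda>z. (a + s * z)\<^sup>2)" unfolding eq by simp
  show "(\<integral>z. (a + s * z)\<^sup>2 \<partial>\<gamma>) = a\<^sup>2 + s\<^sup>2"
    unfolding eq using prob_space by simp
qed

lemma gaussian_law_integrable:
  assumes "gaussian_law \<mu>"
  shows "integrable \<mu> (\<lambda>u. u)" "integrable \<mu> (\<lambda>u. u\<^sup>2)"
proof -
  obtain a s where \<mu>: "\<mu> = distr \<gamma> borel (\<lambda>z. a + s * z)"
    using gaussian_law_eq_distr_std_normal[OF assms] .
  show "integrable \<mu> (\<lambda>u. u)" "integrable \<mu> (\<lambda>u. u\<^sup>2)"
    using integral_std_normal_affine(1)[of a s] integral_std_normal_affine_square(1)[of a s]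
    unfolding \<mu> by (simp_all add: integrable_distr_eq)
qed

lemma char_distr_std_normal_scale:
  "char (distr \<gamma> borel (\<lambda>z. s * z)) t = complex_of_real (exp (- (s\<^sup>2 * t\<^sup>2) / 2))"
proof -
  have "char (distr \<gamma> borel (\<lambda>z. s * z)) t = (CLINT z|\<gamma>. iexp (t * (s * z)))"
    unfolding char_def by (rule integral_distr) auto
  also have "\<dots> = char \<gamma> (t * s)" by (simp add: char_def mult.assoc)
  finally show ?thesis
    by (simp add: char_std_normal_distribution power_mult_distrib mult.commute)
qed

lemma char_centered_gaussian_law:
  assumes "gaussian_law \<mu>" and mean: "(\<integral>u. u \<partial>\<mu>) = 0"
  shows "char \<mu> t = complex_of_real (exp (- ((\<integral>u. u\<^sup>2 \<partial>\<mu>) * t\<^sup>2) / 2))"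
proof -
  obtain a s where \<mu>: "\<mu> = distr \<gamma> borel (\<lambda>z. a + s * z)"
    using gaussian_law_eq_distr_std_normal[OF assms(1)] .
  have "a = 0"
    using mean integral_std_normal_affine(2)[of a s] unfolding \<mu> by (simp add: integral_distr)
  moreover have "(\<integral>u. u\<^sup>2 \<partial>\<mu>) = a\<^sup>2 + s\<^sup>2"
    unfolding \<mu> integral_std_normal_affine_square(2)[symmetric] by (rule integral_distr) auto
  ultimately show ?thesis
    using char_distr_std_normal_scale[of s t] unfolding \<mu> by simp
qed

text \<open>The characteristic functions of \<open>X n\<close> depend on the variance alone, so they
  converge to that of a centred normal law; by dominated convergence they also converge to that of
  \<open>Y\<close>. The limit is written as an image of \<gamma> so that v = 0 is included.\<close>

lemma (in prob_space) distr_limit_centered_gaussian: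
  fixes X :: "nat \<Rightarrow> 'a \<Rightarrow> real"
  assumes [measurable]: "\<And>n. X n \<in> borel_measurable M"
    and gauss: "\<And>n. gaussian_law (distr M borel (X n))"
    and mean: "\<And>n. expectation (X n) = 0"
    and var: "(\<lambda>n. expectation (\<lambda>\<omega>. (X n \<omega>)\<^sup>2)) \<longlonglongrightarrow> v"
    and lim: "\<And>\<omega>. \<omega> \<in> space M \<Longrightarrow> (\<lambda>n. X n \<omega>) \<longlonglongrightarrow> Y \<omega>"
  shows "distr M borel Y = distr \<gamma> borel (\<lambda>z. sqrt v * z)"
proof (rule Levy_uniqueness)
  have [measurable]: "Y \<in> borel_measurable M"
    by (rule borel_measurable_LIMSEQ_real[OF lim]) auto
  then show "real_distribution (distr M borel Y)" by simp
  interpret G: prob_space \<gamma> by (rule prob_space_std_normal)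
  show "real_distribution (distr \<gamma> borel (\<lambda>z. sqrt v * z))"
    by (rule G.real_distribution_distr) simp
  have v: "0 \<le> v" by (rule LIMSEQ_le_const[OF var]) auto
  show "char (distr M borel Y) = char (distr \<gamma> borel (\<lambda>z. sqrt v * z))"
  proof (rule ext)
    fix t
    have "(\<lambda>n. CLINT \<omega>|M. iexp (t * X n \<omega>)) \<longlonglongrightarrow> (CLINT \<omega>|M. iexp (t * Y \<omega>))"
    proof (rule integral_dominated_convergence[where w="\<lambda>_. 1"])
      show "AE \<omega> in M. (\<lambda>n. iexp (t * X n \<omega>)) \<longlonglongrightarrow> iexp (t * Y \<omega>)"
        by (rule AE_I2) (auto intro!: tendsto_intros lim)
    qed auto
    moreover have "(CLINT \<omega>|M. iexp (t * Y \<omega>)) = char (distr M borel Y) t"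
      unfolding char_def by (rule integral_distr[symmetric]) auto
    moreover have "(CLINT \<omega>|M. iexp (t * X n \<omega>)) =
        complex_of_real (exp (- (expectation (\<lambda>\<omega>. (X n \<omega>)\<^sup>2) * t\<^sup>2) / 2))" for n
    proof -
      have "(CLINT \<omega>|M. iexp (t * X n \<omega>)) = char (distr M borel (X n)) t"
        unfolding char_def by (rule integral_distr[symmetric]) auto
      also have "\<dots> = complex_of_real (exp (- ((\<integral>u. u\<^sup>2 \<partial>distr M borel (X n)) * t\<^sup>2) / 2))"
        using mean by (intro char_centered_gaussian_law gauss) (simp add: integral_distr)
      also have "(\<integral>u. u\<^sup>2 \<partial>distr M borel (X n)) = expectation (\<lambda>\<omega>. (X n \<omega>)\<^sup>2)"
        by (rule integral_distr) auto
      finally show ?thesis .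
    qed
    moreover have "(\<lambda>n. complex_of_real (exp (- (expectation (\<lambda>\<omega>. (X n \<omega>)\<^sup>2) * t\<^sup>2) / 2)))
        \<longlonglongrightarrow> complex_of_real (exp (- (v * t\<^sup>2) / 2))"
      by (intro tendsto_intros var) auto
    ultimately have "char (distr M borel Y) t = complex_of_real (exp (- (v * t\<^sup>2) / 2))"
      using LIMSEQ_unique by auto
    then show "char (distr M borel Y) t = char (distr \<gamma> borel (\<lambda>z. sqrt v * z)) t"
      using v by (simp add: char_distr_std_normal_scale)
  qed
qed

section \<open>Linear combinations of backward increments\<close>

lemma fbm_increment_sum:
  fixes c :: "real \<Rightarrow> real"
  assumes fbm: "fractional_brownian_motion H M B" and F: "finite F" "F \<subseteq> {0..t}"
  defines "S \<equiv> \<lambda>\<omega>. \<Sum>s\<in>F. c s * (B t \<omega> - B (t - s) \<omega>)"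
  shows "S \<in> borel_measurable M" (is ?meas)
    and "0 \<le> t \<Longrightarrow> gaussian_law (distr M borel S)" (is "_ \<Longrightarrow> ?gauss")
    and "(\<integral>\<omega>. S \<omega> \<partial>M) = 0" (is ?mean)
    and "(\<integral>\<omega>. (S \<omega>)\<^sup>2 \<partial>M) = (\<Sum>s\<in>F. \<Sum>s'\<in>F. fbm_cov H s s' * (c s * c s'))" (is ?var)
proof -
  interpret prob_space M using fbm by (simp add: fractional_brownian_motion_def)
  have meas: "B t \<in> borel_measurable M" if "0 \<le> t" for t
    using fbm that by (auto simp: fractional_brownian_motion_def gaussian_process_def)
  have gauss: "gaussian_law (distr M borel (\<lambda>\<omega>. \<Sum>t\<in>F. c t * B t \<omega>))" if "finite F" "F \<subseteq> {0..}" for F c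
    using fbm that by (auto simp: fractional_brownian_motion_def gaussian_process_def)
  have cov: "expectation (\<lambda>\<omega>. B s \<omega> * B t \<omega>) = fbm_cov H s t" if "0 \<le> s" "0 \<le> t" for s t
    using fbm that by (auto simp: fractional_brownian_motion_def fbm_cov_def)
  have mean0: "expectation (B t) = 0" if "0 \<le> t" for t
    using fbm that by (auto simp: fractional_brownian_motion_def)
  have gB: "gaussian_law (distr M borel (B t))" if "0 \<le> t" for t
    using gauss[of "{t}" "\<lambda>_. 1"] that by simp
  have int1: "integrable M (B t)" if "0 \<le> t" for t
    using gaussian_law_integrable(1)[OF gB[OF that]] meas[OF that] by (simp add: integrable_distr_eq)
  have int2: "integrable M (\<lambda>\<omega>. (B t \<omega>)\<^sup>2)" if "0 \<le> t" for t
    using gaussian_law_integrable(2)[OF gB[OF that]] meas[OF that] by (simp add: integrable_distr_eq)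
  have int: "integrable M (\<lambda>\<omega>. B s \<omega> * B t \<omega>)" if "0 \<le> s" "0 \<le> t" for s t
  proof (rule Bochner_Integration.integrable_bound)
    show "integrable M (\<lambda>\<omega>. (B s \<omega>)\<^sup>2 + (B t \<omega>)\<^sup>2)" using int2 that by simp
    show "(\<lambda>\<omega>. B s \<omega> * B t \<omega>) \<in> borel_measurable M" using meas that by simp
    have "\<bar>x * y\<bar> \<le> \<bar>x\<^sup>2 + y\<^sup>2\<bar>" for x y :: real
    proof -
      have "0 \<le> (\<bar>x\<bar> - \<bar>y\<bar>)\<^sup>2" by simp
      then have "2 * (\<bar>x\<bar> * \<bar>y\<bar>) \<le> x\<^sup>2 + y\<^sup>2" by (simp add: power2_diff)
      moreover have "0 \<le> \<bar>x\<bar> * \<bar>y\<bar>" by simp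
      ultimately have "\<bar>x\<bar> * \<bar>y\<bar> \<le> x\<^sup>2 + y\<^sup>2" by linarith
      then show ?thesis by (simp add: abs_mult)
    qed
    then show "AE \<omega> in M. norm (B s \<omega> * B t \<omega>) \<le> norm ((B s \<omega>)\<^sup>2 + (B t \<omega>)\<^sup>2)" by simp
  qed
  have Ft: "0 \<le> s" "0 \<le> t - s" "0 \<le> t" if "s \<in> F" for s using F that by auto
  show ?meas unfolding S_def
    using meas Ft by (intro borel_measurable_sum borel_measurable_times borel_measurable_diff) auto
  have D1: "integrable M (\<lambda>\<omega>. B t \<omega> - B (t - s) \<omega>)" "expectation (\<lambda>\<omega>. B t \<omega> - B (t - s) \<omega>) = 0" if "s \<in> F" for s
    using int1[of t] int1[of "t - s"] mean0[of t] mean0[of "t - s"] Ft[OF that] by auto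
  show ?mean unfolding S_def using D1 by (subst Bochner_Integration.integral_sum) auto
  have DD: "integrable M (\<lambda>\<omega>. (B t \<omega> - B (t - s) \<omega>) * (B t \<omega> - B (t - s') \<omega>)) \<and>
      expectation (\<lambda>\<omega>. (B t \<omega> - B (t - s) \<omega>) * (B t \<omega> - B (t - s') \<omega>)) = fbm_cov H s s'"
    if "s \<in> F" "s' \<in> F" for s s'
  proof -
    note nn = Ft[OF that(1)] Ft[OF that(2)]
    have eq: "(B t \<omega> - B (t - s) \<omega>) * (B t \<omega> - B (t - s') \<omega>) = (B t \<omega> * B t \<omega> - B t \<omega> * B (t - s') \<omega>)
        - (B (t - s) \<omega> * B t \<omega> - B (t - s) \<omega> * B (t - s') \<omega>)" for \<omega>
      by (simp add: algebra_simps)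
    \<comment> \<open>All powers of t, t - s and t - s' cancel: looking back from t, the increments
      have the covariance of the motion itself.\<close>
    have "fbm_cov H t t - fbm_cov H t (t - s') - (fbm_cov H (t - s) t - fbm_cov H (t - s) (t - s')) = fbm_cov H s s'"
      using nn by (simp add: fbm_cov_def field_simps abs_minus_commute)
    then show ?thesis unfolding eq using nn by (simp add: int cov)
  qed
  have "(\<integral>\<omega>. (S \<omega>)\<^sup>2 \<partial>M) = (\<integral>\<omega>. (\<Sum>s\<in>F. \<Sum>s'\<in>F. (c s * c s') *
      ((B t \<omega> - B (t - s) \<omega>) * (B t \<omega> - B (t - s') \<omega>))) \<partial>M)"
    by (simp add: S_def power2_eq_square sum_product mult_ac)
  also have "\<dots> = (\<Sum>s\<in>F. \<Sum>s'\<in>F. (c s * c s') * fbm_cov H s s')"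
    using DD by (simp add: Bochner_Integration.integral_sum Bochner_Integration.integrable_sum)
  finally show ?var by (simp add: mult.commute)
  assume t: "0 \<le> t"
  let ?F = "insert t ((\<lambda>s. t - s) ` F)"
  \<comment> \<open>For s = 0 the time t - s coincides with t, so the coefficient at u = t is
    \<open>sum c F\<close>, less c 0 if 0 lies in F.\<close>
  let ?c = "\<lambda>u. (if u = t then sum c F else 0) - (if t - u \<in> F then c (t - u) else 0)"
  have "S \<omega> = (\<Sum>u\<in>?F. ?c u * B u \<omega>)" for \<omega>
  proof -
    have "(\<Sum>u\<in>?F. ?c u * B u \<omega>) = (\<Sum>u\<in>?F. (if u = t then sum c F * B t \<omega> else 0))
        - (\<Sum>u\<in>?F. (if t - u \<in> F then c (t - u) * B u \<omega> else 0))"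
      unfolding sum_subtractf[symmetric] by (intro sum.cong) (auto simp: algebra_simps)
    also have "(\<Sum>u\<in>?F. (if u = t then sum c F * B t \<omega> else 0)) = sum c F * B t \<omega>"
      using F by (simp add: sum.delta)
    also have "(\<Sum>u\<in>?F. (if t - u \<in> F then c (t - u) * B u \<omega> else 0))
        = (\<Sum>u\<in>(\<lambda>s. t - s) ` F. (if t - u \<in> F then c (t - u) * B u \<omega> else 0))"
    proof (rule sum.mono_neutral_right)
      show "\<forall>u\<in>?F - (\<lambda>s. t - s) ` F. (if t - u \<in> F then c (t - u) * B u \<omega> else 0) = 0"
      proof
        fix u assume u: "u \<in> ?F - (\<lambda>s. t - s) ` F"
        have "t - u \<notin> F" using u image_eqI[of u "\<lambda>s. t - s" "t - u" F] by auto
        then show "(if t - u \<in> F then c (t - u) * B u \<omega> else 0) = 0" by simp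
      qed
    qed (use F in auto)
    also have "\<dots> = (\<Sum>s\<in>F. c s * B (t - s) \<omega>)"
      by (subst sum.reindex) (auto simp: inj_on_def)
    finally show ?thesis
      by (simp add: S_def right_diff_distrib sum_subtractf sum_distrib_right)
  qed
  then have "S = (\<lambda>\<omega>. \<Sum>u\<in>?F. ?c u * B u \<omega>)" by blast
  moreover have "finite ?F" "?F \<subseteq> {0..}" using F t by auto
  ultimately show ?gauss using gauss[of ?F ?c] by simp
qed

section \<open>Expectations of finite-valued maps\<close>

lemma (in prob_space) integral_finite_range:
  fixes f :: "'b \<Rightarrow> real"
  assumes F: "finite F" "\<And>a. a \<in> space M \<Longrightarrow> \<phi> a \<in> F"
    and meas: "\<And>s. s \<in> F \<Longrightarrow> \<phi> -` {s} \<inter> space M \<in> sets M"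
  shows "expectation (\<lambda>a. f (\<phi> a)) = (\<Sum>s\<in>F. prob (\<phi> -` {s} \<inter> space M) * f s)"
proof -
  have "expectation (\<lambda>a. f (\<phi> a)) = expectation (\<lambda>a. \<Sum>s\<in>F. indicator (\<phi> -` {s} \<inter> space M) a * f s)"
  proof (rule Bochner_Integration.integral_cong[OF refl])
    fix a assume a: "a \<in> space M"
    have "(\<Sum>s\<in>F. indicator (\<phi> -` {s} \<inter> space M) a * f s) = (\<Sum>s\<in>F. if s = \<phi> a then f s else 0)"
      using a by (intro sum.cong) (auto simp: indicator_def)
    also have "\<dots> = f (\<phi> a)"
      using F(2)[OF a] sum.delta[OF F(1), of "\<phi> a" f] by (simp only: if_True)
    finally show "f (\<phi> a) = (\<Sum>s\<in>F. indicator (\<phi> -` {s} \<inter> space M) a * f s)" ..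
  qed
  also have "\<dots> = (\<Sum>s\<in>F. prob (\<phi> -` {s} \<inter> space M) * f s)"
    using meas by (subst Bochner_Integration.integral_sum) (auto intro!: integrable_real_indicator simp: less_top[symmetric])
  finally show ?thesis .
qed

text \<open>The one-variable formula for the pair-valued map: preimages of points are rectangles,
  whose product measure factorises. The double sum has the shape of the variance of an increment
  sum.\<close>

lemma integral_pair_finite_range:
  fixes f :: "'b \<Rightarrow> 'b \<Rightarrow> real"
  assumes "prob_space M" and F: "finite F" "\<And>a. a \<in> space M \<Longrightarrow> \<phi> a \<in> F"
    and meas: "\<And>s. s \<in> F \<Longrightarrow> \<phi> -` {s} \<inter> space M \<in> sets M"
  shows "(\<integral>u. f (\<phi> (fst u)) (\<phi> (snd u)) \<partial>(M \<Otimes>\<^sub>M M)) =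
    (\<Sum>s\<in>F. \<Sum>s'\<in>F. f s s' * (measure M (\<phi> -` {s} \<inter> space M) * measure M (\<phi> -` {s'} \<inter> space M)))"
proof -
  interpret prob_space M by fact
  interpret P: pair_prob_space M M ..
  have pre: "(\<lambda>u. (\<phi> (fst u), \<phi> (snd u))) -` {(s, s')} \<inter> space (M \<Otimes>\<^sub>M M)
      = (\<phi> -` {s} \<inter> space M) \<times> (\<phi> -` {s'} \<inter> space M)" for s s'
    by (auto simp: space_pair_measure)
  have "(\<integral>u. (\<lambda>(s, s'). f s s') (\<phi> (fst u), \<phi> (snd u)) \<partial>(M \<Otimes>\<^sub>M M)) =
      (\<Sum>p\<in>F \<times> F. measure (M \<Otimes>\<^sub>M M) ((\<lambda>u. (\<phi> (fst u), \<phi> (snd u))) -` {p} \<inter> space (M \<Otimes>\<^sub>M M)) * (case p of (s, s') \<Rightarrow> f s s'))"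
  proof (rule P.integral_finite_range)
    fix p assume p: "p \<in> F \<times> F"
    then show "(\<lambda>u. (\<phi> (fst u), \<phi> (snd u))) -` {p} \<inter> space (M \<Otimes>\<^sub>M M) \<in> sets (M \<Otimes>\<^sub>M M)"
      using meas pre[of "fst p" "snd p"] by auto
  qed (use F in \<open>auto simp: space_pair_measure\<close>)
  also have "\<dots> = (\<Sum>s\<in>F. \<Sum>s'\<in>F. f s s' * (measure M (\<phi> -` {s} \<inter> space M) * measure M (\<phi> -` {s'} \<inter> space M)))"
    unfolding sum.cartesian_product
    using meas by (intro sum.cong)
      (auto simp: pre measure_def emeasure_pair_measure_Times enn2real_mult)
  finally show ?thesis by simp
qed

section \<open>The law of the fractional Ornstein--Uhlenbeck process\<close>

lemma continuous_path_increment: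
  assumes b: "continuous_on {0..t} b" and t: "0 \<le> t"
  shows "continuous_on UNIV (\<lambda>a::real. b t - b (t - min \<bar>a\<bar> t) :: real)"
proof -
  have "continuous_on UNIV (b \<circ> (\<lambda>a::real. t - min \<bar>a\<bar> t))"
  proof (rule continuous_on_compose)
    show "continuous_on UNIV (\<lambda>a::real. t - min \<bar>a\<bar> t)" by (intro continuous_intros)
    show "continuous_on (range (\<lambda>a::real. t - min \<bar>a\<bar> t)) b"
      by (rule continuous_on_subset[OF b]) (use t in auto)
  qed
  then show ?thesis by (intro continuous_intros) (simp add: comp_def)
qed

lemma bounded_path_increment:
  assumes b: "continuous_on {0..t} b" and t: "0 \<le> t"
  obtains C where "\<And>a::real. \<bar>b t - b (t - min \<bar>a\<bar> t) :: real\<bar> \<le> C"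
proof -
  have "compact (b ` {0..t})" using b by (intro compact_continuous_image) auto
  then obtain C where C: "\<And>s. s \<in> {0..t} \<Longrightarrow> \<bar>b s\<bar> \<le> C"
    using compact_imp_bounded bounded_iff by (metis image_eqI real_norm_def)
  have "\<bar>b t - b (t - min \<bar>a\<bar> t)\<bar> \<le> C + C" for a
    using C[of t] C[of "t - min \<bar>a\<bar> t"] t by (auto simp: min_def split: if_splits)
  then show thesis by (rule that)
qed

text \<open>The atom of \<open>min a t\<close> at \<open>t\<close>, of mass \<open>exp (- lam * t)\<close>, absorbs the boundary term of the
  integration by parts. The absolute value only matters on the null set of negative \<open>a\<close>: with it,
  the bounds needed for dominated convergence hold everywhere.\<close>

lemma exp_path_integral_eq_exp_law:
  assumes lam: "0 < lam" and t: "0 \<le> t" and b: "continuous_on {0..t} b" and b0: "b 0 = 0"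
  shows "exp (- lam * t) * exp_path_integral lam b t
    = (\<integral>a. b t - b (t - min \<bar>a\<bar> t) \<partial>exp_law lam)"
proof -
  interpret E: prob_space "exp_law lam" by (rule prob_space_exponential_density[OF lam])
  let ?d = "\<lambda>a. b t - b (t - min \<bar>a\<bar> t)"
  have [measurable]: "?d \<in> borel_measurable borel"
    using continuous_path_increment[OF b t] by (rule borel_measurable_continuous_onI)
  obtain C where C: "\<And>a. \<bar>?d a\<bar> \<le> C" using bounded_path_increment[OF b t] by blast
  have "0 \<le> C" using C[of 0] by simp
  have dens: "distributed (exp_law lam) lborel (\<lambda>x. x) (exponential_density lam)"
    by (simp add: distributed_def distr_id2)
  have tail: "measure (exp_law lam) {t<..} = exp (- lam * t)"
    using E.exponential_distributedD_gt[OF dens t lam] by (simp add: greaterThan_def mult.commute)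
  have i1: "integrable (exp_law lam) (\<lambda>a. indicator {..t} a * ?d a)"
    using C \<open>0 \<le> C\<close> by (intro E.integrable_const_bound[where B=C]) (auto simp: indicator_def)
  have "(\<integral>a. ?d a \<partial>exp_law lam) = (\<integral>a. indicator {..t} a * ?d a + indicator {t<..} a * b t \<partial>exp_law lam)"
    using t b0 by (intro Bochner_Integration.integral_cong) (auto simp: indicator_def)
  also have "\<dots> = (\<integral>a. indicator {..t} a * ?d a \<partial>exp_law lam) + (\<integral>a. indicator {t<..} a * b t \<partial>exp_law lam)"
    by (intro Bochner_Integration.integral_add i1)
       (auto intro!: integrable_real_indicator simp: less_top[symmetric])
  also have "(\<integral>a. indicator {t<..} a * b t \<partial>exp_law lam) = exp (- lam * t) * b t"
    using tail by simp
  also have "(\<integral>a. indicator {..t} a * ?d a \<partial>exp_law lam)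
      = (\<integral>a. exponential_density lam a * (indicator {..t} a * ?d a) \<partial>lborel)"
    using lam by (subst integral_density) (auto simp: exponential_density_nonneg)
  \<comment> \<open>The density vanishes for negative a, and on [0, t] both the absolute value and
    the minimum drop out.\<close>
  also have "\<dots> = (LINT a:{0..t}|lborel. lam * exp (- (lam * a)) * (b t - b (t - a)))"
    unfolding set_lebesgue_integral_def
    by (intro Bochner_Integration.integral_cong)
       (auto simp: indicator_def exponential_density_def mult.commute)
  also have "\<dots> = integral {0..t} (\<lambda>a. lam * exp (- (lam * a)) * (b t - b (t - a)))"
    by (intro set_borel_integral_eq_integral(2) borel_integrable_atLeastAtMost' continuous_intros
        continuous_on_compose2[OF b]) auto
  \<comment> \<open>Writing exp (- lam a) as exp (- lam t) exp (lam (t - a)) prepares the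
    substitution s = t - a.\<close>
  also have "\<dots> = integral {0..t} (\<lambda>a. b t * (lam * exp (- (lam * a))) -
      (lam * exp (- (lam * t))) * (exp (lam * (t - a)) * b (t - a)))"
  proof (rule integral_cong)
    fix a
    have "exp (- (lam * t)) * exp (lam * (t - a)) = exp (- (lam * a))"
      by (simp add: exp_add[symmetric] algebra_simps)
    then show "lam * exp (- (lam * a)) * (b t - b (t - a)) = b t * (lam * exp (- (lam * a))) -
      (lam * exp (- (lam * t))) * (exp (lam * (t - a)) * b (t - a))"
      by (simp add: algebra_simps)
  qed
  also have "\<dots> = b t * integral {0..t} (\<lambda>a. lam * exp (- (lam * a))) -
      (lam * exp (- (lam * t))) * integral {0..t} (\<lambda>a. exp (lam * (t - a)) * b (t - a))"
    by (subst integral_diff)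
       (auto intro!: integrable_continuous_interval continuous_intros continuous_on_compose2[OF b])
  also have "integral {0..t} (\<lambda>a. lam * exp (- (lam * a))) = 1 - exp (- (lam * t))"
  proof -
    have "((\<lambda>a. lam * exp (- (lam * a))) has_integral (- exp (- (lam * t)) - (- exp (- (lam * 0))))) {0..t}"
      by (rule fundamental_theorem_of_calculus[OF t])
         (auto simp: has_real_derivative_iff_has_vector_derivative[symmetric] intro!: derivative_eq_intros)
    from integral_unique[OF this] show ?thesis by (simp only: mult_zero_right minus_zero exp_zero)
  qed
  \<comment> \<open>Time reversal s = t - a, composed of a reflection and a shift.\<close>
  also have "integral {0..t} (\<lambda>a. exp (lam * (t - a)) * b (t - a)) = integral {0..t} (\<lambda>s. exp (lam * s) * b s)"
    (is "_ = integral _ ?g")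
    using integral_shift_real_ivl[of "- t" "- t" 0 "\<lambda>x. ?g (- x)"] Henstock_Kurzweil_Integration.integral_reflect_real[of t 0 ?g] by simp
  finally have "(\<integral>a. ?d a \<partial>exp_law lam) =
      b t * (1 - exp (- (lam * t))) - lam * exp (- (lam * t)) * integral {0..t} ?g + exp (- lam * t) * b t" .
  moreover have "exp (- (lam * t)) * exp (lam * t) = 1" by (simp add: exp_add[symmetric])
  then have "exp (- (lam * t)) * (exp (lam * t) * b t) = b t" by (metis mult.assoc mult_1)
  ultimately show ?thesis
    by (simp add: exp_path_integral_def algebra_simps)
qed

text \<open>Rounding down to multiples of 1 / (n + 1) keeps the value below |a|, so the majorant
  survives discretisation; truncation at t leaves finitely many values. \<open>Suc n\<close> avoids
  division by zero.\<close>

definition grid_approx :: "nat \<Rightarrow> real \<Rightarrow> real \<Rightarrow> real" where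
  "grid_approx n t a = min (of_int \<lfloor>real (Suc n) * \<bar>a\<bar>\<rfloor> / real (Suc n)) t"

lemma borel_measurable_grid_approx[measurable]: "grid_approx n t \<in> borel_measurable borel"
  unfolding grid_approx_def by measurable

lemma grid_approx_bounds:
  assumes "0 \<le> t"
  shows "0 \<le> grid_approx n t a" "grid_approx n t a \<le> \<bar>a\<bar>" "grid_approx n t a \<le> t"
proof -
  have "of_int \<lfloor>real (Suc n) * \<bar>a\<bar>\<rfloor> \<le> real (Suc n) * \<bar>a\<bar>" by (rule of_int_floor_le)
  then have "of_int \<lfloor>real (Suc n) * \<bar>a\<bar>\<rfloor> / real (Suc n) \<le> \<bar>a\<bar>" by (simp add: field_simps)
  then show "grid_approx n t a \<le> \<bar>a\<bar>" by (simp add: grid_approx_def min.coboundedI1)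
  show "0 \<le> grid_approx n t a" "grid_approx n t a \<le> t"
    using assms by (simp_all add: grid_approx_def)
qed

lemma finite_range_grid_approx:
  assumes "0 \<le> t"
  shows "finite (range (grid_approx n t))"
proof (rule finite_subset)
  let ?I = "{0..\<lceil>real (Suc n) * t\<rceil>}"
  show "range (grid_approx n t) \<subseteq> insert t ((\<lambda>k. of_int k / real (Suc n)) ` ?I)"
  proof (rule image_subsetI)
    fix a
    let ?k = "\<lfloor>real (Suc n) * \<bar>a\<bar>\<rfloor>"
    show "grid_approx n t a \<in> insert t ((\<lambda>k. of_int k / real (Suc n)) ` ?I)"
    proof (cases "of_int ?k / real (Suc n) < t")
      case True
      then have "of_int ?k \<le> real (Suc n) * t" by (simp add: field_simps)
      then have "?k \<in> ?I" by (auto simp del: of_nat_Suc) linarith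
      then show ?thesis using True by (auto simp: grid_approx_def)
    qed (simp add: grid_approx_def)
  qed
qed auto

lemma grid_approx_tendsto: "(\<lambda>n. grid_approx n t a) \<longlonglongrightarrow> min \<bar>a\<bar> t"
proof -
  have "(\<lambda>n. of_int \<lfloor>real (Suc n) * \<bar>a\<bar>\<rfloor> / real (Suc n)) \<longlonglongrightarrow> \<bar>a\<bar>"
  proof (rule tendsto_sandwich)
    show "\<forall>\<^sub>F n in sequentially. \<bar>a\<bar> - 1 / real (Suc n) \<le> of_int \<lfloor>real (Suc n) * \<bar>a\<bar>\<rfloor> / real (Suc n)"
    proof (rule always_eventually, rule allI)
      fix n
      have "real (Suc n) * \<bar>a\<bar> - 1 \<le> of_int \<lfloor>real (Suc n) * \<bar>a\<bar>\<rfloor>" by linarith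
      then have "(real (Suc n) * \<bar>a\<bar> - 1) / real (Suc n) \<le> of_int \<lfloor>real (Suc n) * \<bar>a\<bar>\<rfloor> / real (Suc n)"
        by (rule divide_right_mono) simp
      then show "\<bar>a\<bar> - 1 / real (Suc n) \<le> of_int \<lfloor>real (Suc n) * \<bar>a\<bar>\<rfloor> / real (Suc n)"
        by (simp add: diff_divide_distrib del: of_nat_Suc)
    qed
    show "\<forall>\<^sub>F n in sequentially. of_int \<lfloor>real (Suc n) * \<bar>a\<bar>\<rfloor> / real (Suc n) \<le> \<bar>a\<bar>"
    proof (rule always_eventually, rule allI)
      fix n
      have "of_int \<lfloor>real (Suc n) * \<bar>a\<bar>\<rfloor> \<le> real (Suc n) * \<bar>a\<bar>" by (rule of_int_floor_le)
      then show "of_int \<lfloor>real (Suc n) * \<bar>a\<bar>\<rfloor> / real (Suc n) \<le> \<bar>a\<bar>" by (simp add: field_simps)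
    qed
    have "(\<lambda>n. \<bar>a\<bar> - 1 / real (Suc n)) \<longlonglongrightarrow> \<bar>a\<bar> - 0"
      by (intro tendsto_intros LIMSEQ_inverse_real_of_nat[unfolded inverse_eq_divide])
    then show "(\<lambda>n. \<bar>a\<bar> - 1 / real (Suc n)) \<longlonglongrightarrow> \<bar>a\<bar>" by simp
  qed simp
  then show ?thesis unfolding grid_approx_def by (intro tendsto_min tendsto_const)
qed

text \<open>The variance of exp (- lam t) times the path integral, as the covariance averaged over
  two independent exponential times truncated at t. In this form t enters through the truncation
  alone.\<close>

definition ou_variance :: "real \<Rightarrow> real \<Rightarrow> real \<Rightarrow> real" where
  "ou_variance H lam t =
     (\<integral>u. fbm_cov H (min \<bar>fst u\<bar> t) (min \<bar>snd u\<bar> t) \<partial>(exp_law lam \<Otimes>\<^sub>M exp_law lam))"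

lemma ou_variance_tendsto:
  assumes "0 < H" "0 < lam"
  shows "(ou_variance H lam \<longlongrightarrow> limit_variance H lam) at_top"
proof (rule tendsto_at_topI_sequentially)
  fix T :: "nat \<Rightarrow> real" assume T: "filterlim T at_top sequentially"
  \<comment> \<open>The convergence lemma asks for nonnegative times at every index, whereas
    \<open>T n\<close> is nonnegative only eventually.\<close>
  have max: "filterlim (\<lambda>n. max 0 (T n)) at_top sequentially"
    by (rule filterlim_at_top_mono[OF T]) auto
  have "(\<lambda>n. \<integral>u. fbm_cov H (min \<bar>fst u\<bar> (max 0 (T n))) (min \<bar>snd u\<bar> (max 0 (T n))) \<partial>(exp_law lam \<Otimes>\<^sub>M exp_law lam))
    \<longlonglongrightarrow> (\<integral>u. fbm_cov H \<bar>fst u\<bar> \<bar>snd u\<bar> \<partial>(exp_law lam \<Otimes>\<^sub>M exp_law lam))"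
  proof (rule tendsto_integral_fbm_cov[OF assms, where \<phi> = "\<lambda>n a. min \<bar>a\<bar> (max 0 (T n))" and \<psi> = abs])
    fix a :: real
    have "eventually (\<lambda>n. \<bar>a\<bar> \<le> T n) sequentially"
      using T by (simp add: filterlim_at_top)
    then have "eventually (\<lambda>n. min \<bar>a\<bar> (max 0 (T n)) = \<bar>a\<bar>) sequentially"
      by eventually_elim auto
    then show "(\<lambda>n. min \<bar>a\<bar> (max 0 (T n))) \<longlonglongrightarrow> \<bar>a\<bar>" by (rule tendsto_eventually)
  qed auto
  then have "(\<lambda>n. ou_variance H lam (max 0 (T n))) \<longlonglongrightarrow> limit_variance H lam"
    by (simp add: ou_variance_def integral_fbm_cov_exp_law[OF assms])
  moreover have "eventually (\<lambda>n. ou_variance H lam (max 0 (T n)) = ou_variance H lam (T n)) sequentially"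
    using T unfolding filterlim_at_top by (auto elim!: allE[of _ 0] eventually_mono)
  ultimately show "(\<lambda>n. ou_variance H lam (T n)) \<longlonglongrightarrow> limit_variance H lam"
    by (rule Lim_transform_eventually)
qed

lemma distr_scaled_exp_path_integral:
  assumes H: "0 < H" and lam: "0 < lam" and fbm: "fractional_brownian_motion H M B" and t: "0 \<le> t"
  defines "Y \<equiv> \<lambda>\<omega>. exp (- lam * t) * exp_path_integral lam (\<lambda>s. B s \<omega>) t"
  shows "Y \<in> borel_measurable M"
    and "distr M borel Y = distr \<gamma> borel (\<lambda>z. sqrt (ou_variance H lam t) * z)"
proof -
  interpret prob_space M using fbm by (simp add: fractional_brownian_motion_def)
  interpret E: prob_space "exp_law lam" by (rule prob_space_exponential_density[OF lam])
  let ?\<phi> = "\<lambda>n. grid_approx n t"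
  let ?F = "\<lambda>n. range (?\<phi> n)"
  let ?c = "\<lambda>n s. measure (exp_law lam) (?\<phi> n -` {s} \<inter> space (exp_law lam))"
  \<comment> \<open>The weights \<open>?c n s\<close> are the probabilities that the rounded
    exponential time equals s, so \<open>S n\<close> averages the backward increment over that
    time.\<close>
  define S where "S n \<omega> = (\<Sum>s\<in>?F n. ?c n s * (B t \<omega> - B (t - s) \<omega>))" for n \<omega>
  have F: "finite (?F n)" "?F n \<subseteq> {0..t}" for n
    using finite_range_grid_approx[OF t] grid_approx_bounds[OF t] by auto
  have pre: "?\<phi> n -` {s} \<inter> space (exp_law lam) \<in> sets (exp_law lam)" for n s
    using measurable_sets[OF borel_measurable_grid_approx, of "{s}" n t] by simp
  have S: "S n \<in> borel_measurable M" "gaussian_law (distr M borel (S n))" "expectation (S n) = 0"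
    "expectation (\<lambda>\<omega>. (S n \<omega>)\<^sup>2) = (\<Sum>s\<in>?F n. \<Sum>s'\<in>?F n. fbm_cov H s s' * (?c n s * ?c n s'))" for n
    using fbm_increment_sum[OF fbm F, of "?c n" n] t unfolding S_def by auto
  have "expectation (\<lambda>\<omega>. (S n \<omega>)\<^sup>2) =
      (\<integral>u. fbm_cov H (?\<phi> n (fst u)) (?\<phi> n (snd u)) \<partial>(exp_law lam \<Otimes>\<^sub>M exp_law lam))" for n
    unfolding S(4)
    by (rule integral_pair_finite_range[symmetric, OF E.prob_space_axioms F(1) _ pre]) simp
  moreover have "(\<lambda>n. \<integral>u. fbm_cov H (?\<phi> n (fst u)) (?\<phi> n (snd u)) \<partial>(exp_law lam \<Otimes>\<^sub>M exp_law lam))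
      \<longlonglongrightarrow> ou_variance H lam t"
    unfolding ou_variance_def
    by (rule tendsto_integral_fbm_cov[OF H lam, where \<psi> = "\<lambda>a. min \<bar>a\<bar> t"])
       (auto simp: grid_approx_bounds[OF t] grid_approx_tendsto)
  ultimately have var: "(\<lambda>n. expectation (\<lambda>\<omega>. (S n \<omega>)\<^sup>2)) \<longlonglongrightarrow> ou_variance H lam t" by simp
  have lim: "(\<lambda>n. S n \<omega>) \<longlonglongrightarrow> Y \<omega>" if \<omega>: "\<omega> \<in> space M" for \<omega>
  proof -
    let ?b = "\<lambda>s. B s \<omega>"
    let ?d = "\<lambda>a. ?b t - ?b (t - min \<bar>a\<bar> t)"
    have b: "continuous_on {0..t} ?b" "?b 0 = 0"
      using fbm \<omega> by (auto simp: fractional_brownian_motion_def intro: continuous_on_subset[of "{0..}"])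
    have cont: "continuous_on UNIV ?d" by (rule continuous_path_increment[OF b(1) t])
    then have [measurable]: "?d \<in> borel_measurable borel" by (rule borel_measurable_continuous_onI)
    obtain C where C: "\<And>a. \<bar>?d a\<bar> \<le> C" using bounded_path_increment[OF b(1) t] by blast
    \<comment> \<open>Grid values already lie in [0, t], so truncating once more inside
      \<open>?d\<close> changes nothing.\<close>
    have [simp]: "min \<bar>?\<phi> n a\<bar> t = ?\<phi> n a" for n a
      using grid_approx_bounds[OF t, of n a] by simp
    have "S n \<omega> = (\<integral>a. ?b t - ?b (t - ?\<phi> n a) \<partial>exp_law lam)" for n
      unfolding S_def
      using E.integral_finite_range[OF F(1)[of n] _ pre, where f = "\<lambda>s. ?b t - ?b (t - s)"] by simp
    then have S_eq: "S n \<omega> = (\<integral>a. ?d (?\<phi> n a) \<partial>exp_law lam)" for n by simp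
    have "(\<lambda>n. \<integral>a. ?d (?\<phi> n a) \<partial>exp_law lam) \<longlonglongrightarrow> (\<integral>a. ?d a \<partial>exp_law lam)"
    proof (rule integral_dominated_convergence[where w="\<lambda>_. C"])
      show "AE a in exp_law lam. (\<lambda>n. ?d (?\<phi> n a)) \<longlonglongrightarrow> ?d a"
      proof (rule AE_I2)
        fix a
        have "isCont ?d (min \<bar>a\<bar> t)" using cont by (simp add: continuous_on_eq_continuous_at)
        from isCont_tendsto_compose[OF this grid_approx_tendsto]
        show "(\<lambda>n. ?d (?\<phi> n a)) \<longlonglongrightarrow> ?d a" using t by simp
      qed
      show "(\<lambda>a. ?d (?\<phi> n a)) \<in> borel_measurable (exp_law lam)" for n
        using measurable_compose[OF borel_measurable_grid_approx, of ?d borel n t] by simp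
      show "AE a in exp_law lam. norm (?d (?\<phi> n a)) \<le> C" for n
        using C by (intro AE_I2) (simp only: real_norm_def)
    qed auto
    then show ?thesis
      unfolding S_eq Y_def exp_path_integral_eq_exp_law[OF lam t b] .
  qed
  \<comment> \<open>Measurability of the path integral in \<omega> comes from the pointwise limit of
    the measurable sums.\<close>
  show "Y \<in> borel_measurable M"
    by (rule borel_measurable_LIMSEQ_real[OF lim S(1)])
  show "distr M borel Y = distr \<gamma> borel (\<lambda>z. sqrt (ou_variance H lam t) * z)"
    by (rule distr_limit_centered_gaussian[OF S(1,2,3) var lim])
qed

text \<open>The affine form also covers t = 0, where the variance is 0 and the law is the point mass
  at x.\<close>

lemma distr_fractional_OU:
  assumes H: "0 < H" and lam: "0 < lam" and fbm: "fractional_brownian_motion H M B" and t: "0 \<le> t"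
  shows "distr M borel (fractional_OU lam B x \<epsilon> t) =
    distr \<gamma> borel (\<lambda>z. exp (- lam * t) * x + \<epsilon> * sqrt (ou_variance H lam t) * z)"
proof -
  let ?Y = "\<lambda>\<omega>. exp (- lam * t) * exp_path_integral lam (\<lambda>s. B s \<omega>) t"
  let ?g = "\<lambda>y. exp (- lam * t) * x + \<epsilon> * y"
  note Y = distr_scaled_exp_path_integral[OF H lam fbm t]
  have "fractional_OU lam B x \<epsilon> t = ?g \<circ> ?Y"
    by (auto simp: fractional_OU_def mult.assoc)
  then have "distr M borel (fractional_OU lam B x \<epsilon> t) = distr (distr M borel ?Y) borel ?g"
    using Y(1) by (simp add: distr_distr)
  also have "\<dots> = distr \<gamma> borel (\<lambda>z. exp (- lam * t) * x + \<epsilon> * sqrt (ou_variance H lam t) * z)"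
    unfolding Y(2) by (subst distr_distr) (auto simp: comp_def mult.assoc)
  finally show ?thesis .
qed

section \<open>The cutoff profile and the limit at the cutoff time\<close>

lemma limit_variance_pos:
  assumes "0 < H" "0 < lam"
  shows "0 < limit_variance H lam"
  using assms by (simp add: limit_variance_def Gamma_real_pos)

lemma cutoff_profile_eq:
  assumes "0 < H" "0 < lam" "1 \<le> p"
  shows "cutoff_profile H lam x p w r = exp (- lam * r * w) * \<bar>x\<bar>"
  using assms by (simp add: cutoff_profile_def wasserstein_normal_law_same_variance limit_variance_pos abs_mult)

theorem theorem2p4:
  fixes H lam x p w\<^sub>0 :: real
    and M :: "'a measure" and B :: "real \<Rightarrow> 'a \<Rightarrow> real"
    and N :: "real \<Rightarrow> 'b measure" and Xinf :: "real \<Rightarrow> 'b \<Rightarrow> real"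
    and w :: "real \<Rightarrow> real"
  assumes "0 < H" and "H < 1" and "0 < lam" and "1 \<le> p"
    and "fractional_brownian_motion H M B"
    and "\<And>\<epsilon>. 0 < \<epsilon> \<Longrightarrow> prob_space (N \<epsilon>)"
    and "\<And>\<epsilon>. 0 < \<epsilon> \<Longrightarrow> Xinf \<epsilon> \<in> borel_measurable (N \<epsilon>)"
    and "\<And>\<epsilon>. 0 < \<epsilon> \<Longrightarrow> distr (N \<epsilon>) borel (Xinf \<epsilon>) = normal_law 0 (\<epsilon>\<^sup>2 * limit_variance H lam)"
    and "(w \<longlongrightarrow> w\<^sub>0) (at_right 0)" and "0 < w\<^sub>0"
  shows "(\<forall>r. ((\<lambda>\<epsilon>. 1 / \<epsilon> * wasserstein p
                  (distr M borel (fractional_OU lam B x \<epsilon> (cutoff_time lam \<epsilon> + r * w \<epsilon>)))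
                  (distr (N \<epsilon>) borel (Xinf \<epsilon>)))
               \<longlongrightarrow> cutoff_profile H lam x p w\<^sub>0 r) (at_right 0)) \<and>
         (x \<noteq> 0 \<longrightarrow>
            filterlim (cutoff_profile H lam x p w\<^sub>0) at_top at_bot \<and>
            (cutoff_profile H lam x p w\<^sub>0 \<longlongrightarrow> 0) at_top)"
proof -
  note H = assms(1) and lam = assms(3) and p = assms(4) and w0 = assms(10)
  have profile: "cutoff_profile H lam x p w\<^sub>0 = (\<lambda>r. exp (- lam * r * w\<^sub>0) * \<bar>x\<bar>)"
    using cutoff_profile_eq[OF H lam p] by blast
  show ?thesis
  proof (intro conjI allI impI)
    fix r
    define T where "T \<epsilon> = cutoff_time lam \<epsilon> + r * w \<epsilon>" for \<epsilon>
    let ?R = "limit_variance H lam"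
    let ?a = "\<lambda>\<epsilon>. exp (- lam * r * w \<epsilon>) * x"
    let ?s = "\<lambda>\<epsilon>. sqrt (ou_variance H lam (T \<epsilon>))"
    have pos: "eventually (\<lambda>\<epsilon>. 0 < \<epsilon>) (at_right (0::real))"
      by (simp add: eventually_at_right_less)
    have "filterlim (\<lambda>\<epsilon>. 1 / lam * ln (1 / \<epsilon>)) at_top (at_right (0::real))"
      using lam by real_asymp
    \<comment> \<open>\<open>r * w \<epsilon>\<close> converges, so it cannot offset the divergence
      of the cutoff time, whatever the sign of r.\<close>
    then have T: "filterlim T at_top (at_right 0)"
      unfolding T_def cutoff_time_def
      using filterlim_tendsto_add_at_top[OF tendsto_mult[OF tendsto_const[of r] assms(9)]]
      by (subst add.commute)
    have a: "(?a \<longlongrightarrow> exp (- lam * r * w\<^sub>0) * x) (at_right 0)"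
      by (intro tendsto_intros assms(9))
    have s: "(?s \<longlongrightarrow> sqrt ?R) (at_right 0)"
      by (intro tendsto_real_sqrt filterlim_compose[OF ou_variance_tendsto[OF H lam] T])
    \<comment> \<open>For negative r the time may be negative for large \<epsilon>; the law of the
      process is available once it is nonnegative.\<close>
    have "eventually (\<lambda>\<epsilon>. 0 \<le> T \<epsilon>) (at_right 0)"
      using T by (simp add: filterlim_at_top)
    then have "eventually (\<lambda>\<epsilon>. 1 / \<epsilon> * wasserstein p (distr \<gamma> borel (\<lambda>z. \<epsilon> * ?a \<epsilon> + \<epsilon> * ?s \<epsilon> * z))
              (distr \<gamma> borel (\<lambda>z. 0 + \<epsilon> * sqrt ?R * z)) =
        1 / \<epsilon> * wasserstein p (distr M borel (fractional_OU lam B x \<epsilon> (T \<epsilon>))) (distr (N \<epsilon>) borel (Xinf \<epsilon>)))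
        (at_right 0)"
      using pos
    proof eventually_elim
      case (elim \<epsilon>)
      \<comment> \<open>The choice of cutoff time: the deterministic decay equals \<epsilon> up to a
        factor with a positive limit, so mean and standard deviation are both scaled by
        \<epsilon>.\<close>
      have "- lam * T \<epsilon> = ln \<epsilon> + (- lam * r * w \<epsilon>)"
        using lam elim by (simp add: T_def cutoff_time_def ln_div algebra_simps)
      then have "exp (- lam * T \<epsilon>) = \<epsilon> * exp (- lam * r * w \<epsilon>)"
        using elim by (simp only: exp_add exp_ln)
      then have 1: "distr M borel (fractional_OU lam B x \<epsilon> (T \<epsilon>)) = distr \<gamma> borel (\<lambda>z. \<epsilon> * ?a \<epsilon> + \<epsilon> * ?s \<epsilon> * z)"
        using distr_fractional_OU[OF H lam assms(5) elim(1), of x \<epsilon>] by (simp add: mult.assoc)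
      have 2: "distr (N \<epsilon>) borel (Xinf \<epsilon>) = distr \<gamma> borel (\<lambda>z. 0 + \<epsilon> * sqrt ?R * z)"
        using assms(8)[OF elim(2)] elim limit_variance_pos[OF H lam]
        by (simp add: normal_law_eq_distr real_sqrt_mult)
      show ?case unfolding 1 2 ..
    qed
    from Lim_transform_eventually[OF tendsto_scaled_wasserstein_normal[OF p pos a s] this]
    show "((\<lambda>\<epsilon>. 1 / \<epsilon> * wasserstein p
                    (distr M borel (fractional_OU lam B x \<epsilon> (cutoff_time lam \<epsilon> + r * w \<epsilon>)))
                    (distr (N \<epsilon>) borel (Xinf \<epsilon>)))
                 \<longlongrightarrow> cutoff_profile H lam x p w\<^sub>0 r) (at_right 0)"
      unfolding profile by (simp add: T_def abs_mult)
  next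
    assume x: "x \<noteq> 0"
    have x': "0 < \<bar>x\<bar>" using x by simp
    show "filterlim (cutoff_profile H lam x p w\<^sub>0) at_top at_bot"
      unfolding profile using lam w0 x' by real_asymp
    show "(cutoff_profile H lam x p w\<^sub>0 \<longlongrightarrow> 0) at_top"
      unfolding profile using lam w0 by real_asymp
  qed
qed

end
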